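(* Let $\Lambda$ be a lattice with $\Lambda\neq 0$, let $V=\mathbb{R}\otimes_{\mathbb{Z}}\Lambda$, and let $\varphi\in V^*$ with $\varphi\neq 0$. Then: (a) The topological space $\mathcal{P}os(\Lambda)$ is connected, and it is not Hausdorff if $\Lambda\neq 0$. (b) The maps $\pi:\mathcal{P}os(\Lambda)\to V^*/\mathbb{R}_{>0}$ and $\overline{\mathrm{Pos}}:V^*/\mathbb{R}_{>0}\to\mathcal{P}os(\Lambda)$ are continuous and satisfy $\pi\circ\overline{\mathrm{Pos}}=\mathrm{Id}_{V^*/\mathbb{R}_{>0}}$. (c) $\overline{\mathrm{Pos}}$ induces a homeomorphism onto its image, and this image is dense in $\mathcal{P}os(\Lambda)$. (d) $\pi^{-1}(\bar\varphi)$ is the intersection of all neighbourhoods of $\mathrm{Pos}(\varphi)$ in $\mathcal{P}os(\Lambda)$. (e) The map $i_{\bar\varphi}:\mathcal{P}os(\operatorname{Ker}\varphi|_\Lambda)\to\pi^{-1}(\bar\varphi)$, $X\mapsto X\cup\mathrm{Pos}^+(\varphi)$, is a homeomorphism (where $\pi^{-1}(\bar\varphi)$ carries the subspace topology from $\mathcal{P}os(\Lambda)$).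
   Context: A lattice is a free abelian group of finite rank. For a lattice $\Lambda$, a subset $X\subseteq\Lambda$ is called positive if (P1) $\Lambda=X\cup(-X)$; (P2) $X+X\subseteq X$; (P3) $X\cap(-X)$ is a subgroup of $\Lambda$. $\mathcal{P}os(\Lambda)$ denotes the set of positive subsets of $\Lambda$ (so $\Lambda\in\mathcal{P}os(\Lambda)$). Topology: for $E\subseteq\Lambda$ put $\mathcal{U}(E)=\{X\in\mathcal{P}os(\Lambda)\mid X\cap E=\varnothing\}$. A subset $\mathcal{U}$ of $\mathcal{P}os(\Lambda)$ is open if for every $X\in\mathcal{U}$ there is a finite subset $E\subseteq\Lambda$ with $X\in\mathcal{U}(E)\subseteq\mathcal{U}$. The same definition applies to the lattice $\operatorname{Ker}\varphi|_\Lambda$. $V^*$ is the real dual of $V$ with its usual topology; $V^*/\mathbb{R}_{>0}$ is the quotient by the scaling action of positive reals (including the class $\bar 0$ of $0$), with the quotient topology; $\bar\varphi$ is the class of $\varphi$. For $\varphi\in V^*$, $\mathrm{Pos}(\varphi)=\{\lambda\in\Lambda\mid\varphi(\lambda)\ge 0\}$ and $\mathrm{Pos}^+(\varphi)=\{\lambda\in\Lambda\mid\varphi(\lambda)>0\}$; $\mathrm{Pos}(\varphi)$ is a positive subset of $\Lambda$. $\overline{\mathrm{Pos}}(\bar\varphi):=\mathrm{Pos}(\varphi)$. The map $\pi$: $\pi(\Lambda)=\bar 0$, and if $X\in\mathcal{P}os(\Lambda)$, $X\ne\Lambda$, then $\pi(X)$ is the unique class $\bar\varphi$ of a nonzero linear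 form $\varphi$ on $V$ such that $X\subseteq\mathrm{Pos}(\varphi)$ (existence and uniqueness hold). For $\varphi\ne0$ the map $i_{\bar\varphi}$ in (e) is well defined with values in $\pi^{-1}(\bar\varphi)$. *)

theory Defs
  imports
    "HOL-Analysis.Analysis"
    "HOL-Computational_Algebra.Group_Closure"
    "HOL-Library.Poly_Mapping"
begin

section \<open>Lattices\<close>

definition add_subgroup :: "'l::ab_group_add set \<Rightarrow> bool" where
  "add_subgroup H \<longleftrightarrow> 0 \<in> H \<and> (\<forall>x\<in>H. \<forall>y\<in>H. x + y \<in> H) \<and> (\<forall>x\<in>H. - x \<in> H)"

text \<open>The group \<open>\<int>\<^sup>n\<close> is represented by the functions \<open>nat \<Rightarrow> int\<close> that vanish from \<open>n\<close> on;
  \<open>f\<close> is a group isomorphism onto it.\<close>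

definition is_lattice :: "'l::ab_group_add set \<Rightarrow> bool" where
  "is_lattice L \<longleftrightarrow> add_subgroup L \<and>
     (\<exists>(n::nat) (f::'l \<Rightarrow> nat \<Rightarrow> int).
        bij_betw f L {g. \<forall>i\<ge>n. g i = 0} \<and>
        (\<forall>x\<in>L. \<forall>y\<in>L. \<forall>i. f (x + y) i = f x i + f y i))"


section \<open>The space of positive subsets\<close>

definition Pos_sets :: "'l::ab_group_add set \<Rightarrow> 'l set set" where
  "Pos_sets L = {X. L = X \<union> uminus ` X \<and> (\<forall>x\<in>X. \<forall>y\<in>X. x + y \<in> X) \<and>
     add_subgroup (X \<inter> uminus ` X)}"

definition avoiding :: "'l::ab_group_add set \<Rightarrow> 'l set \<Rightarrow> 'l set set" where
  "avoiding L E = {X \<in> Pos_sets L. X \<inter> E = {}}"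

definition Pos_topology :: "'l::ab_group_add set \<Rightarrow> 'l set topology" where
  "Pos_topology L = topology (\<lambda>U. U \<subseteq> Pos_sets L \<and>
     (\<forall>X\<in>U. \<exists>E. finite E \<and> E \<subseteq> L \<and> X \<in> avoiding L E \<and> avoiding L E \<subseteq> U))"

lemma openin_Pos_topology:
  "openin (Pos_topology L) U \<longleftrightarrow> U \<subseteq> Pos_sets L \<and>
     (\<forall>X\<in>U. \<exists>E. finite E \<and> E \<subseteq> L \<and> X \<in> avoiding L E \<and> avoiding L E \<subseteq> U)"
proof -
  let ?P = "\<lambda>U. U \<subseteq> Pos_sets L \<and>
     (\<forall>X\<in>U. \<exists>E. finite E \<and> E \<subseteq> L \<and> X \<in> avoiding L E \<and> avoiding L E \<subseteq> U)"
  have "istopology ?P"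
    unfolding istopology_def
  proof (intro conjI allI impI)
    fix S T assume S: "?P S" and T: "?P T"
    show "S \<inter> T \<subseteq> Pos_sets L" using S by blast
    show "\<forall>X\<in>S \<inter> T. \<exists>E. finite E \<and> E \<subseteq> L \<and> X \<in> avoiding L E \<and> avoiding L E \<subseteq> S \<inter> T"
    proof
      fix X assume "X \<in> S \<inter> T"
      then obtain E F where "finite E" "E \<subseteq> L" "X \<in> avoiding L E" "avoiding L E \<subseteq> S"
        and "finite F" "F \<subseteq> L" "X \<in> avoiding L F" "avoiding L F \<subseteq> T"
        using S T by (metis IntE)
      moreover have "avoiding L (E \<union> F) = avoiding L E \<inter> avoiding L F"
        by (auto simp: avoiding_def)
      ultimately show "\<exists>E. finite E \<and> E \<subseteq> L \<and> X \<in> avoiding L E \<and> avoiding L E \<subseteq> S \<inter> T"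
        by (intro exI[of _ "E \<union> F"]) auto
    qed
  next
    fix \<K> assume K: "\<forall>U\<in>\<K>. ?P U"
    show "\<Union>\<K> \<subseteq> Pos_sets L" using K by blast
    show "\<forall>X\<in>\<Union>\<K>. \<exists>E. finite E \<and> E \<subseteq> L \<and> X \<in> avoiding L E \<and> avoiding L E \<subseteq> \<Union>\<K>"
    proof
      fix X assume "X \<in> \<Union>\<K>"
      then obtain U where U: "U \<in> \<K>" "X \<in> U" by blast
      then obtain E where "finite E" "E \<subseteq> L" "X \<in> avoiding L E" "avoiding L E \<subseteq> U"
        using K by meson
      with U show "\<exists>E. finite E \<and> E \<subseteq> L \<and> X \<in> avoiding L E \<and> avoiding L E \<subseteq> \<Union>\<K>"
        by (intro exI[of _ E]) blast
    qed
  qed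
  then show ?thesis
    unfolding Pos_topology_def by (simp add: topology_inverse')
qed

lemma topspace_Pos_topology [simp]: "topspace (Pos_topology L) = Pos_sets L"
proof -
  have "openin (Pos_topology L) (Pos_sets L)"
    unfolding openin_Pos_topology by (auto intro!: exI[of _ "{}"] simp: avoiding_def)
  then show ?thesis
    by (meson openin_Pos_topology openin_subset openin_topspace subset_antisym)
qed


section \<open>The real vector space \<open>\<real> \<otimes>\<^sub>\<int> \<Lambda>\<close>\<close>

text \<open>The tensor product over \<open>\<int>\<close> is the free abelian group on \<open>\<real> \<times> \<Lambda>\<close> modulo the
  subgroup generated by the biadditivity relations; balancedness over \<open>\<int>\<close>
  follows from these.\<close>

definition tensor_rels :: "((real \<times> 'l::ab_group_add) \<Rightarrow>\<^sub>0 int) set" where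
  "tensor_rels = group_closure
     ({frag_of (r + s, a) - frag_of (r, a) - frag_of (s, a) | r s a. True} \<union>
      {frag_of (r, a + b) - frag_of (r, a) - frag_of (r, b) | r a b. True})"

definition tensor_eq ::
    "((real \<times> 'l::ab_group_add) \<Rightarrow>\<^sub>0 int) \<Rightarrow> ((real \<times> 'l) \<Rightarrow>\<^sub>0 int) \<Rightarrow> bool" where
  "tensor_eq u v \<longleftrightarrow> u - v \<in> tensor_rels"

lemma tensor_rels_add: "u \<in> tensor_rels \<Longrightarrow> v \<in> tensor_rels \<Longrightarrow> u + v \<in> tensor_rels"
  unfolding tensor_rels_def by (rule group_closure_add)

lemma tensor_rels_diff: "u \<in> tensor_rels \<Longrightarrow> v \<in> tensor_rels \<Longrightarrow> u - v \<in> tensor_rels"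
  unfolding tensor_rels_def by (rule group_closure.diff)

lemma tensor_rels_uminus: "u \<in> tensor_rels \<Longrightarrow> - u \<in> tensor_rels"
  unfolding tensor_rels_def by simp

lemma tensor_rels_zero: "0 \<in> tensor_rels"
  unfolding tensor_rels_def by simp

lemma tensor_rels_left: "frag_of (r + s, a) - frag_of (r, a) - frag_of (s, a) \<in> tensor_rels"
  unfolding tensor_rels_def by (rule group_closure.base) blast

lemma tensor_rels_right: "frag_of (r, a + b) - frag_of (r, a) - frag_of (r, b) \<in> tensor_rels"
  unfolding tensor_rels_def by (rule group_closure.base) blast

lemma equivp_tensor_eq:
  "equivp (tensor_eq :: ((real \<times> 'l::ab_group_add) \<Rightarrow>\<^sub>0 int) \<Rightarrow> _ \<Rightarrow> bool)"
proof (rule equivpI)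
  show "reflp (tensor_eq :: ((real \<times> 'l) \<Rightarrow>\<^sub>0 int) \<Rightarrow> _)" by (simp add: reflp_def tensor_eq_def tensor_rels_zero)
  show "symp (tensor_eq :: ((real \<times> 'l) \<Rightarrow>\<^sub>0 int) \<Rightarrow> _)"
    unfolding symp_def tensor_eq_def by (metis minus_diff_eq tensor_rels_uminus)
  show "transp (tensor_eq :: ((real \<times> 'l) \<Rightarrow>\<^sub>0 int) \<Rightarrow> _)"
    unfolding transp_def tensor_eq_def
  proof (intro allI impI)
    fix u v w :: "(real \<times> 'l::ab_group_add) \<Rightarrow>\<^sub>0 int"
    assume "u - v \<in> tensor_rels" "v - w \<in> tensor_rels"
    then have "(u - v) + (v - w) \<in> tensor_rels" by (rule tensor_rels_add)
    then show "u - w \<in> tensor_rels" by simp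
  qed
qed

quotient_type (overloaded) 'l real_tensor =
  "(real \<times> 'l::ab_group_add) \<Rightarrow>\<^sub>0 int" / tensor_eq
  by (rule equivp_tensor_eq)

definition frag_scale ::
    "real \<Rightarrow> ((real \<times> 'l) \<Rightarrow>\<^sub>0 int) \<Rightarrow> ((real \<times> 'l) \<Rightarrow>\<^sub>0 int)" where
  "frag_scale c = frag_extend (\<lambda>(r, a). frag_of (c * r, a))"

lemma frag_scale_simps [simp]:
  "frag_scale c (frag_of (r, a)) = frag_of (c * r, a)"
  "frag_scale c 0 = 0"
  "frag_scale c (u + v) = frag_scale c u + frag_scale c v"
  "frag_scale c (u - v) = frag_scale c u - frag_scale c v"
  by (simp_all add: frag_scale_def frag_extend_add frag_extend_diff)

lemma frag_scale_rels: "u \<in> tensor_rels \<Longrightarrow> frag_scale c u \<in> tensor_rels"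
  unfolding tensor_rels_def
proof (induction rule: group_closure.induct)
  case (base s)
  then show ?case
    using tensor_rels_left[of "c * _" "c * _"] tensor_rels_right[of "c * _"] tensor_rels_zero
    unfolding tensor_rels_def by (auto simp: distrib_left)
next
  case (diff s t)
  then show ?case by (simp add: group_closure.diff)
qed

lemma frag_scale_scale: "frag_scale c (frag_scale d u) = frag_scale (c * d) u"
  by (rule frag_induction[of u UNIV]) (auto simp: mult.assoc)

lemma frag_scale_one: "frag_scale 1 u = u"
  by (rule frag_induction[of u UNIV]) auto

lemma frag_scale_add_left:
  "frag_scale (c + d) u - (frag_scale c u + frag_scale d u) \<in> tensor_rels"
proof (rule frag_induction[of u UNIV])
  fix x :: "real \<times> 'a"
  show "frag_scale (c + d) (frag_of x) - (frag_scale c (frag_of x) + frag_scale d (frag_of x))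
      \<in> tensor_rels"
    using tensor_rels_left[of "c * fst x" "d * fst x" "snd x"]
    by (cases x) (simp add: distrib_right algebra_simps)
next
  fix u v :: "(real \<times> 'a) \<Rightarrow>\<^sub>0 int"
  assume "frag_scale (c + d) u - (frag_scale c u + frag_scale d u) \<in> tensor_rels"
    and "frag_scale (c + d) v - (frag_scale c v + frag_scale d v) \<in> tensor_rels"
  from tensor_rels_diff[OF this]
  show "frag_scale (c + d) (u - v) - (frag_scale c (u - v) + frag_scale d (u - v))
      \<in> tensor_rels"
    by (simp add: algebra_simps)
qed (auto simp: tensor_rels_zero)

instantiation real_tensor :: (ab_group_add) real_vector
begin

lift_definition zero_real_tensor :: "'a real_tensor" is 0 .

lift_definition plus_real_tensor :: "'a real_tensor \<Rightarrow> 'a real_tensor \<Rightarrow> 'a real_tensor" is "(+)"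
  unfolding tensor_eq_def by (drule (1) tensor_rels_add) (simp add: algebra_simps)

lift_definition uminus_real_tensor :: "'a real_tensor \<Rightarrow> 'a real_tensor" is uminus
  unfolding tensor_eq_def by (drule tensor_rels_uminus) (simp add: algebra_simps)

lift_definition minus_real_tensor :: "'a real_tensor \<Rightarrow> 'a real_tensor \<Rightarrow> 'a real_tensor" is "(-)"
  unfolding tensor_eq_def by (drule (1) tensor_rels_diff) (simp add: algebra_simps)

lift_definition scaleR_real_tensor :: "real \<Rightarrow> 'a real_tensor \<Rightarrow> 'a real_tensor" is frag_scale
  unfolding tensor_eq_def by (drule frag_scale_rels) simp

instance
proof
  fix a b :: real and x y z :: "'a real_tensor"
  show "x + y + z = x + (y + z)"
    by transfer (simp add: tensor_eq_def tensor_rels_zero add.assoc)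
  show "x + y = y + x"
    by transfer (simp add: tensor_eq_def tensor_rels_zero add.commute)
  show "0 + x = x"
    by transfer (simp add: tensor_eq_def tensor_rels_zero)
  show "- x + x = 0"
    by transfer (simp add: tensor_eq_def tensor_rels_zero)
  show "x - y = x + - y"
    by transfer (simp add: tensor_eq_def tensor_rels_zero)
  show "a *\<^sub>R (x + y) = a *\<^sub>R x + a *\<^sub>R y"
    by transfer (simp add: tensor_eq_def tensor_rels_zero)
  show "(a + b) *\<^sub>R x = a *\<^sub>R x + b *\<^sub>R x"
    by transfer (simp add: tensor_eq_def frag_scale_add_left)
  show "a *\<^sub>R b *\<^sub>R x = (a * b) *\<^sub>R x"
    by transfer (simp add: tensor_eq_def tensor_rels_zero frag_scale_scale)
  show "1 *\<^sub>R x = x"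
    by transfer (simp add: tensor_eq_def tensor_rels_zero frag_scale_one)
qed

end

lift_definition tensor :: "real \<Rightarrow> 'l::ab_group_add \<Rightarrow> 'l real_tensor"  (infix \<open>\<otimes>\<^sub>R\<close> 75)
  is "\<lambda>r a. frag_of (r, a)" .


section \<open>The dual space and its quotient by positive scalars\<close>

definition dual :: "('v::real_vector \<Rightarrow> real) set" where
  "dual = {\<phi>. linear \<phi>}"

text \<open>The ambient topology on \<open>'v \<Rightarrow> real\<close> is the product topology, so this is the topology of
  pointwise convergence. For finite-dimensional \<open>'v\<close> it is the usual topology of the dual.\<close>

definition dual_topology :: "('v::real_vector \<Rightarrow> real) topology" where
  "dual_topology = top_of_set dual"

definition quotient_topology :: "'a topology \<Rightarrow> 'a rel \<Rightarrow> 'a set topology" where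
  "quotient_topology T r =
     topology (\<lambda>U. U \<subseteq> topspace T // r \<and> openin T {x \<in> topspace T. r `` {x} \<in> U})"

lemma openin_quotient_topology:
  "openin (quotient_topology T r) U \<longleftrightarrow>
     U \<subseteq> topspace T // r \<and> openin T {x \<in> topspace T. r `` {x} \<in> U}"
proof -
  have "istopology (\<lambda>U. U \<subseteq> topspace T // r \<and> openin T {x \<in> topspace T. r `` {x} \<in> U})"
    unfolding istopology_def
  proof (intro conjI allI impI; (elim conjE)?)
    fix S U
    assume "openin T {x \<in> topspace T. r `` {x} \<in> S}" "openin T {x \<in> topspace T. r `` {x} \<in> U}"
    then have "openin T ({x \<in> topspace T. r `` {x} \<in> S} \<inter> {x \<in> topspace T. r `` {x} \<in> U})"
      by (rule openin_Int)
    then show "openin T {x \<in> topspace T. r `` {x} \<in> S \<inter> U}"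
      by (rule back_subst) auto
  next
    fix \<K>
    assume K: "\<forall>U\<in>\<K>. U \<subseteq> topspace T // r \<and> openin T {x \<in> topspace T. r `` {x} \<in> U}"
    have "openin T (\<Union>U\<in>\<K>. {x \<in> topspace T. r `` {x} \<in> U})"
      using K by (intro openin_Union) auto
    then show "openin T {x \<in> topspace T. r `` {x} \<in> \<Union>\<K>}"
      by (rule back_subst) auto
  qed auto
  then show ?thesis
    unfolding quotient_topology_def by (simp add: topology_inverse')
qed

lemma topspace_quotient_topology [simp]: "topspace (quotient_topology T r) = topspace T // r"
proof -
  have "{x \<in> topspace T. r `` {x} \<in> topspace T // r} = topspace T"
    by (auto intro: quotientI)
  then have "openin (quotient_topology T r) (topspace T // r)"
    unfolding openin_quotient_topology by simp
  then show ?thesis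
    by (meson openin_quotient_topology openin_subset openin_topspace subset_antisym)
qed

definition pos_scaling :: "('v::real_vector \<Rightarrow> real) rel" where
  "pos_scaling = {(\<phi>, \<psi>). \<phi> \<in> dual \<and> \<psi> \<in> dual \<and> (\<exists>c>0. \<psi> = (\<lambda>v. c * \<phi> v))}"

lemma equiv_pos_scaling: "equiv dual (pos_scaling :: ('v::real_vector \<Rightarrow> real) rel)"
proof (rule equivI)
  show "(pos_scaling :: ('v \<Rightarrow> real) rel) \<subseteq> dual \<times> dual" by (auto simp: pos_scaling_def)
  show "refl_on dual (pos_scaling :: ('v \<Rightarrow> real) rel)"
    by (auto simp: pos_scaling_def refl_on_def intro: exI[of _ 1])
  show "sym (pos_scaling :: ('v \<Rightarrow> real) rel)"
  proof (rule symI)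
    fix \<phi> \<psi> :: "'v \<Rightarrow> real" assume "(\<phi>, \<psi>) \<in> pos_scaling"
    then obtain c where c: "c > 0" "\<psi> = (\<lambda>v. c * \<phi> v)" and d: "\<phi> \<in> dual" "\<psi> \<in> dual"
      unfolding pos_scaling_def by auto
    from c have "inverse c > 0" "\<phi> = (\<lambda>v. inverse c * \<psi> v)" by auto
    with d show "(\<psi>, \<phi>) \<in> pos_scaling" unfolding pos_scaling_def by blast
  qed
  show "trans (pos_scaling :: ('v \<Rightarrow> real) rel)"
  proof (rule transI)
    fix \<phi> \<psi> \<theta> :: "'v \<Rightarrow> real" assume "(\<phi>, \<psi>) \<in> pos_scaling" "(\<psi>, \<theta>) \<in> pos_scaling"
    then obtain c d where "c > 0" "\<psi> = (\<lambda>v. c * \<phi> v)" "d > 0" "\<theta> = (\<lambda>v. d * \<psi> v)"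
      and "\<phi> \<in> dual" "\<theta> \<in> dual"
      unfolding pos_scaling_def by auto
    then show "(\<phi>, \<theta>) \<in> pos_scaling"
      unfolding pos_scaling_def by (auto intro!: exI[of _ "d * c"] simp: mult.assoc)
  qed
qed

definition ray :: "('v::real_vector \<Rightarrow> real) \<Rightarrow> ('v \<Rightarrow> real) set" where
  "ray \<phi> = pos_scaling `` {\<phi>}"

definition ray_topology :: "('v::real_vector \<Rightarrow> real) set topology" where
  "ray_topology = quotient_topology dual_topology pos_scaling"


section \<open>The maps between positive subsets and rays\<close>

definition Pos :: "('l::ab_group_add real_tensor \<Rightarrow> real) \<Rightarrow> 'l set" where
  "Pos \<phi> = {l. \<phi> (1 \<otimes>\<^sub>R l) \<ge> 0}"

definition Pos_plus :: "('l::ab_group_add real_tensor \<Rightarrow> real) \<Rightarrow> 'l set" where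
  "Pos_plus \<phi> = {l. \<phi> (1 \<otimes>\<^sub>R l) > 0}"

definition Ker :: "('l::ab_group_add real_tensor \<Rightarrow> real) \<Rightarrow> 'l set" where
  "Ker \<phi> = {l. \<phi> (1 \<otimes>\<^sub>R l) = 0}"

definition Pos_bar :: "('l::ab_group_add real_tensor \<Rightarrow> real) set \<Rightarrow> 'l set" where
  "Pos_bar c = the_elem (Pos ` c)"

lemma Pos_bar_ray:
  assumes "linear \<phi>"
  shows "Pos_bar (ray \<phi>) = Pos \<phi>"
proof -
  have "\<phi> \<in> ray \<phi>"
    using assms unfolding ray_def pos_scaling_def by (auto simp: dual_def intro: exI[of _ 1])
  moreover have "Pos \<psi> = Pos \<phi>" if "\<psi> \<in> ray \<phi>" for \<psi>
    using that unfolding ray_def pos_scaling_def Pos_def by (auto simp: zero_le_mult_iff)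
  ultimately have "Pos ` ray \<phi> = {Pos \<phi>}"
    by (metis (no_types, lifting) empty_iff image_cong image_constant)
  then show ?thesis by (simp add: Pos_bar_def)
qed

definition ray_of :: "'l::ab_group_add set \<Rightarrow> ('l real_tensor \<Rightarrow> real) set" where
  "ray_of X = (if X = UNIV then ray (\<lambda>_. 0)
     else THE c. \<exists>\<phi>. linear \<phi> \<and> \<phi> \<noteq> (\<lambda>_. 0) \<and> X \<subseteq> Pos \<phi> \<and> c = ray \<phi>)"

definition ray_fibre :: "('l::ab_group_add real_tensor \<Rightarrow> real) set \<Rightarrow> 'l set set" where
  "ray_fibre c = {X \<in> Pos_sets UNIV. ray_of X = c}"

end

theory Submission
  imports Defs
begin

text \<open>
  Write \<open>X*\<close> for \<open>X - (- X)\<close>. In coordinates, Fourier--Motzkin elimination shows that every finite subset of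
  \<open>X*\<close> admits a linear form that is positive on it; applied to \<open>- E\<close> this says that every basic open set
  \<open>\<U>(E)\<close> around \<open>X\<close> contains some \<open>Pos \<phi>\<close>, which is density. Forms normalised to sup-norm \<open>1\<close> on a
  basis are a compact set, so the finite intersection property yields a nonzero form with
  \<open>X \<subseteq> Pos \<phi>\<close>. It is unique up to scaling because \<open>X\<close> then contains \<open>Pos\<^sup>+ \<phi>\<close>, and a form that is
  nonnegative there is a multiple of \<open>\<phi>\<close>. The same compactness gives continuity of \<open>\<pi>\<close>, and
  \<open>\<pi> \<circ> Pos = Id\<close> makes \<open>Pos\<close> an embedding.
\<close>

section \<open>Linear forms on the real tensor product\<close>

lemma tensor_add_right: "r \<otimes>\<^sub>R (a + b) = r \<otimes>\<^sub>R a + r \<otimes>\<^sub>R b"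
  by transfer (use tensor_rels_right in \<open>simp add: tensor_eq_def diff_diff_eq\<close>)

lemma tensor_zero_right [simp]: "r \<otimes>\<^sub>R 0 = 0"
  using tensor_add_right[of r 0 0] by simp

lemma tensor_minus_right: "r \<otimes>\<^sub>R (- a) = - (r \<otimes>\<^sub>R a)"
  using tensor_add_right[of r a "- a"] by (simp add: eq_neg_iff_add_eq_0 add.commute)

lemma tensor_eq_scaleR: "r \<otimes>\<^sub>R a = r *\<^sub>R (1 \<otimes>\<^sub>R a)"
  by transfer (simp add: tensor_eq_def tensor_rels_zero)

lemma real_tensor_abs_cases:
  obtains u where "v = abs_real_tensor u"
  using Quotient3_abs_rep[OF Quotient3_real_tensor, of v] by metis

text \<open>Pure tensors generate V already as an abelian group, since scalars are absorbed into
  their first factor; hence there is no case for scalar multiples.\<close>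

lemma real_tensor_induct [case_names zero tensor diff]:
  assumes "P 0" "\<And>r a. P (r \<otimes>\<^sub>R a)" "\<And>u v. P u \<Longrightarrow> P v \<Longrightarrow> P (u - v)"
  shows "P v"
proof -
  obtain u where u: "v = abs_real_tensor u" by (rule real_tensor_abs_cases)
  have "P (abs_real_tensor u)"
  proof (rule frag_induction[of u UNIV])
    show "P (abs_real_tensor 0)"
      using assms(1) by (simp add: zero_real_tensor.abs_eq)
    show "P (abs_real_tensor (frag_of x))" for x
      using assms(2)[of "fst x" "snd x"] by (simp add: tensor.abs_eq)
    show "P (abs_real_tensor (a - b))" if "P (abs_real_tensor a)" "P (abs_real_tensor b)" for a b
      using assms(3)[OF that] by (simp add: minus_real_tensor.abs_eq)
  qed simp
  with u show ?thesis by simp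
qed

text \<open>Universal property: the evaluation \<open>E\<close> of formal sums kills both families
  of biadditivity relations, so it descends to the quotient.\<close>

lemma ex_linear_tensor:
  fixes h :: "'l::ab_group_add \<Rightarrow> real"
  assumes "\<And>x y. h (x + y) = h x + h y"
  shows "\<exists>\<phi>. linear \<phi> \<and> (\<forall>l. \<phi> (1 \<otimes>\<^sub>R l) = h l)"
proof -
  define E :: "((real \<times> 'l) \<Rightarrow>\<^sub>0 int) \<Rightarrow> real" where
    "E u = (\<Sum>x\<in>Poly_Mapping.keys u. of_int (Poly_Mapping.lookup u x) * (fst x * h (snd x)))" for u
  \<comment> \<open>The support depends on \<open>u\<close>; a common finite index set allows
    termwise comparison of the sums for different formal sums.\<close>
  have E_eq: "E u = (\<Sum>x\<in>A. of_int (Poly_Mapping.lookup u x) * (fst x * h (snd x)))"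
    if "finite A" "Poly_Mapping.keys u \<subseteq> A" for u A
    unfolding E_def using that by (intro sum.mono_neutral_left) (auto simp: in_keys_iff)
  have E_diff: "E (u - v) = E u - E v" for u v
  proof -
    define A where "A = Poly_Mapping.keys u \<union> Poly_Mapping.keys v"
    have "finite A" "Poly_Mapping.keys u \<subseteq> A" "Poly_Mapping.keys v \<subseteq> A"
      "Poly_Mapping.keys (u - v) \<subseteq> A"
      unfolding A_def by (auto simp: keys_diff)
    then show ?thesis
      by (simp add: E_eq[of A] lookup_minus left_diff_distrib sum_subtractf)
  qed
  have E_0 [simp]: "E 0 = 0" by (simp add: E_def)
  have E_add: "E (u + v) = E u + E v" for u v
    using E_diff[of "u + v" v] by simp
  have E_of [simp]: "E (frag_of (r, a)) = r * h a" for r a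
    by (simp add: E_def)
  have E_rels: "E u = 0" if "u \<in> tensor_rels" for u
    using that unfolding tensor_rels_def
  proof (induction rule: group_closure.induct)
    case (base s)
    then show ?case
      by (auto simp: E_diff assms distrib_left distrib_right simp del: diff_diff_eq diff_diff_eq2)
  qed (simp_all add: E_diff)
  have E_scale: "E (frag_scale c u) = c * E u" for c u
    by (rule frag_induction[of u UNIV]) (auto simp: E_diff algebra_simps)
  have E_cong: "E u = E v" if "tensor_eq u v" for u v
    using E_rels[of "u - v"] that by (simp add: tensor_eq_def E_diff)
  \<comment> \<open>The representative is arbitrary; \<open>E_cong\<close> makes the value
    independent of it.\<close>
  define \<phi> where "\<phi> v = E (rep_real_tensor v)" for v
  have \<phi>: "\<phi> (abs_real_tensor u) = E u" for u
    unfolding \<phi>_def by (rule E_cong) (metis Quotient3_real_tensor rep_abs_rsp_left Quotient3_def equivp_tensor_eq equivp_reflp)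
  have "linear \<phi>"
  proof (rule linearI)
    show "\<phi> (u + v) = \<phi> u + \<phi> v" for u v
      by (rule real_tensor_abs_cases[of u]; rule real_tensor_abs_cases[of v])
        (simp add: plus_real_tensor.abs_eq \<phi> E_add)
    show "\<phi> (c *\<^sub>R u) = c *\<^sub>R \<phi> u" for c u
      by (rule real_tensor_abs_cases[of u]) (simp add: scaleR_real_tensor.abs_eq \<phi> E_scale)
  qed
  moreover have "\<phi> (1 \<otimes>\<^sub>R l) = h l" for l
    by (simp add: tensor.abs_eq \<phi>)
  ultimately show ?thesis by blast
qed

lemma linear_tensor_simps:
  assumes "linear \<phi>"
  shows "\<phi> (1 \<otimes>\<^sub>R (a + b)) = \<phi> (1 \<otimes>\<^sub>R a) + \<phi> (1 \<otimes>\<^sub>R b)"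
    and "\<phi> (1 \<otimes>\<^sub>R (- a)) = - \<phi> (1 \<otimes>\<^sub>R a)"
    and "\<phi> (1 \<otimes>\<^sub>R 0) = 0"
  using assms by (simp_all add: tensor_add_right tensor_minus_right linear_add linear_neg linear_0)

text \<open>The pure tensors generate V, and each of them is a real multiple of some tensor with
  first factor 1.\<close>

lemma linear_tensor_ext:
  assumes "linear \<phi>" "linear \<psi>" "\<And>l. \<phi> (1 \<otimes>\<^sub>R l) = \<psi> (1 \<otimes>\<^sub>R l)"
  shows "\<phi> = \<psi>"
proof
  fix v show "\<phi> v = \<psi> v"
  proof (induction v rule: real_tensor_induct)
    case (tensor r a)
    then show ?case
      using assms by (subst (1 2) tensor_eq_scaleR) (simp add: linear_scale)
  qed (use assms in \<open>auto simp: linear_0 linear_diff\<close>)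
qed

lemma linear_scaled: "linear \<phi> \<Longrightarrow> linear (\<lambda>v. c * \<phi> v :: real)"
  using linear_compose_scale_right[of \<phi> c] by simp

lemma linear_zero_form: "linear (\<lambda>_. 0 :: real)"
  by (simp add: linear_iff)

lemma Pos_plus_nonempty:
  assumes "linear \<phi>" "\<phi> \<noteq> (\<lambda>_. 0)"
  obtains a where "a \<in> Pos_plus \<phi>"
proof -
  obtain l where "\<phi> (1 \<otimes>\<^sub>R l) \<noteq> 0"
    using linear_tensor_ext[OF assms(1) linear_zero_form] assms(2) by blast
  then have "l \<in> Pos_plus \<phi> \<or> - l \<in> Pos_plus \<phi>"
    using assms(1) by (auto simp: Pos_plus_def linear_tensor_simps)
  with that show thesis by blast
qed


text \<open>Linearity is a family of equations between finitely many point evaluations each, and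
  these are continuous in the product topology. Needed for the compactness of
  \<open>unit_forms\<close>.\<close>

lemma closed_dual: "closed (dual :: ('v::real_vector \<Rightarrow> real) set)"
proof -
  have eq: "dual = {\<psi> :: 'v \<Rightarrow> real. \<forall>x y. \<psi> (x + y) = \<psi> x + \<psi> y} \<inter> {\<psi>. \<forall>r x. \<psi> (r *\<^sub>R x) = r * \<psi> x}"
    by (auto simp: dual_def linear_iff)
  have additive: "closed {\<psi> :: 'v \<Rightarrow> real. \<forall>x y. \<psi> (x + y) = \<psi> x + \<psi> y}"
    by (intro closed_Collect_all closed_Collect_eq continuous_intros continuous_on_product_coordinates)
  have homogeneous: "closed {\<psi> :: 'v \<Rightarrow> real. \<forall>r x. \<psi> (r *\<^sub>R x) = r * \<psi> x}"
    by (intro closed_Collect_all closed_Collect_eq continuous_intros continuous_on_product_coordinates)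
  show ?thesis unfolding eq by (rule closed_Int[OF additive homogeneous])
qed


section \<open>Positive subsets\<close>

lemma in_uminus_image_iff [simp]: "x \<in> uminus ` X \<longleftrightarrow> - x \<in> (X :: 'a::group_add set)"
  by (metis image_iff minus_minus)

text \<open>X \<inter> -X is symmetric and inherits closure under addition from X, so being a
  subgroup comes down to containing 0.\<close>

lemma Pos_sets_iff:
  "X \<in> Pos_sets L \<longleftrightarrow> L = X \<union> uminus ` X \<and> (\<forall>x\<in>X. \<forall>y\<in>X. x + y \<in> X) \<and> 0 \<in> X"
  unfolding Pos_sets_def add_subgroup_def
  by (auto simp del: minus_add_distrib simp: minus_add)

lemma Pos_sets_cases: "X \<in> Pos_sets UNIV \<Longrightarrow> x \<in> X \<or> - x \<in> X"
  unfolding Pos_sets_iff by (metis UNIV_I Un_iff in_uminus_image_iff)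

lemma Pos_in_Pos_sets: "linear \<phi> \<Longrightarrow> Pos \<phi> \<in> Pos_sets UNIV"
  by (auto simp: Pos_sets_iff Pos_def linear_tensor_simps linear_0)

lemma UNIV_in_Pos_sets: "UNIV \<in> Pos_sets UNIV"
  by (auto simp: Pos_sets_iff)

lemma Pos_neq_UNIV:
  assumes "linear \<phi>" "\<phi> \<noteq> (\<lambda>_. 0)"
  shows "Pos \<phi> \<noteq> UNIV"
proof -
  obtain a where "a \<in> Pos_plus \<phi>" using Pos_plus_nonempty[OF assms] .
  then have "- a \<notin> Pos \<phi>" using assms(1) by (simp add: Pos_def Pos_plus_def linear_tensor_simps)
  then show ?thesis by blast
qed

text \<open>If -(x + y) were in X, adding y would put -x in X. Thus X* absorbs the addition of
  elements of all of X.\<close>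

lemma strictly_positive_add:
  assumes "X \<in> Pos_sets UNIV" "x \<in> X - uminus ` X" "y \<in> X"
  shows "x + y \<in> X - uminus ` X"
proof -
  have "- x \<in> X" if "- (x + y) \<in> X"
  proof -
    have "- (x + y) + y \<in> X" using assms that unfolding Pos_sets_iff by blast
    then show ?thesis by (simp add: algebra_simps)
  qed
  then show ?thesis using assms unfolding Pos_sets_iff by auto
qed

lemma strictly_positive_nonempty:
  assumes "X \<in> Pos_sets UNIV" "X \<noteq> UNIV"
  obtains a where "a \<in> X - uminus ` X"
proof -
  from assms(2) obtain l where "l \<notin> X" by blast
  with Pos_sets_cases[OF assms(1), of l] have "- l \<in> X - uminus ` X" by simp
  then show thesis by (rule that)
qed

text \<open>If \<phi> is positive at l, then -l lies outside Pos \<phi> and hence outside X, so X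
  must contain l.\<close>

lemma Pos_plus_subset:
  assumes "X \<in> Pos_sets UNIV" "linear \<phi>" "X \<subseteq> Pos \<phi>"
  shows "Pos_plus \<phi> \<subseteq> X"
proof
  fix l assume l: "l \<in> Pos_plus \<phi>"
  then have "- l \<notin> Pos \<phi>" using assms(2) by (simp add: Pos_def Pos_plus_def linear_tensor_simps)
  then show "l \<in> X" using Pos_sets_cases[OF assms(1)] assms(3) by blast
qed


section \<open>Lattice coordinates\<close>

lemma ex_between_finite:
  fixes A B :: "real set"
  assumes "finite A" "finite B" "\<And>a b. a \<in> A \<Longrightarrow> b \<in> B \<Longrightarrow> a < b"
  shows "\<exists>t. (\<forall>a\<in>A. a < t) \<and> (\<forall>b\<in>B. t < b)"
\<comment> \<open>\<open>Max\<close> and \<open>Min\<close> are meaningful only for nonempty sets; a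
  one-sided constraint is met by moving 1 past the extreme value.\<close>
proof (cases "A = {} \<or> B = {}")
  case True
  then show ?thesis
  proof
    assume "A = {}"
    moreover have "\<forall>b\<in>B. Min B - 1 < b" using Min_le[OF assms(2)] by fastforce
    ultimately show ?thesis by blast
  next
    assume "B = {}"
    moreover have "\<forall>a\<in>A. a < Max A + 1" using Max_ge[OF assms(1)] by fastforce
    ultimately show ?thesis by blast
  qed
next
  case False
  then have "Max A < Min B" using assms by simp
  then obtain t where "Max A < t" "t < Min B" using dense by blast
  then show ?thesis using assms False by auto
qed

text \<open>The isomorphism whose existence \<open>is_lattice\<close> asserts is fixed here, so that
  basis vectors and integer multiples can be defined from it.\<close>

locale lattice_coordinates =
  fixes n :: nat and f :: "'l::ab_group_add \<Rightarrow> nat \<Rightarrow> int"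
  assumes bij: "bij_betw f UNIV {g. \<forall>i\<ge>n. g i = 0}"
    and add: "f (x + y) i = f x i + f y i"
begin

lemma coord_zero [simp]: "f 0 i = 0"
  using add[of 0 0 i] by simp

lemma coord_ge [simp]: "i \<ge> n \<Longrightarrow> f x i = 0"
  using bij by (auto simp: bij_betw_def)

lemma coord_eqI:
  assumes "\<And>i. f x i = f y i"
  shows "x = y"
proof -
  have "f x = f y" using assms by blast
  then show ?thesis using bij by (auto simp: bij_betw_def inj_on_def)
qed

text \<open>Defined through coordinates, so that identities between integer multiples reduce to
  integer arithmetic by \<open>coord_eqI\<close>.\<close>

definition zscale :: "int \<Rightarrow> 'l \<Rightarrow> 'l" where
  "zscale k x = inv_into UNIV f (\<lambda>i. k * f x i)"

text \<open>The guard i < n keeps the prescribed function in the image of \<open>f\<close> for every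
  j; for j \<ge> n the result is 0.\<close>

definition unit :: "nat \<Rightarrow> 'l" where
  "unit j = inv_into UNIV f (\<lambda>i. if i = j \<and> i < n then 1 else 0)"

lemma coord_inv: "(\<And>i. i \<ge> n \<Longrightarrow> g i = 0) \<Longrightarrow> f (inv_into UNIV f g) i = g i"
  using bij_betw_inv_into_right[OF bij, of g] by auto

lemma coord_zscale [simp]: "f (zscale k x) i = k * f x i"
  unfolding zscale_def by (rule coord_inv) simp

lemma coord_unit: "f (unit j) i = (if i = j \<and> i < n then 1 else 0)"
  unfolding unit_def by (rule coord_inv) simp

lemma coord_sum: "f (sum g A) i = (\<Sum>a\<in>A. f (g a) i)"
  by (induction A rule: infinite_finite_induct) (auto simp: add)

lemma zscale_Suc: "zscale (1 + k) x = x + zscale k x"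
  by (rule coord_eqI) (simp add: add algebra_simps)

lemma zscale_0 [simp]: "zscale 0 x = 0"
  by (rule coord_eqI) simp

lemma zscale_uminus: "zscale (- k) x = - zscale k x"
proof -
  have "zscale (- k) x + zscale k x = 0" by (rule coord_eqI) (simp add: add)
  then show ?thesis by (simp add: eq_neg_iff_add_eq_0)
qed

lemma coord_expansion: "x = (\<Sum>j<n. zscale (f x j) (unit j))"
proof (rule coord_eqI)
  fix i
  have "f (\<Sum>j<n. zscale (f x j) (unit j)) i = (\<Sum>j<n. if i = j \<and> i < n then f x j else 0)"
    by (auto simp: coord_sum coord_unit intro!: sum.cong)
  also have "\<dots> = f x i" by (cases "i < n") (simp_all add: sum.delta')
  finally show "f x i = f (\<Sum>j<n. zscale (f x j) (unit j)) i" by simp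
qed

lemma linear_tensor_zscale:
  assumes "linear (\<phi> :: 'l real_tensor \<Rightarrow> real)"
  shows "\<phi> (1 \<otimes>\<^sub>R zscale k x) = of_int k * \<phi> (1 \<otimes>\<^sub>R x)"
proof -
  have nat: "\<phi> (1 \<otimes>\<^sub>R zscale (int m) x) = of_nat m * \<phi> (1 \<otimes>\<^sub>R x)" for m
    by (induction m) (simp_all add: linear_tensor_simps[OF assms] zscale_Suc linear_0[OF assms] algebra_simps)
  show ?thesis
    by (cases k) (simp_all only: nat zscale_uminus linear_tensor_simps[OF assms] of_int_minus
        of_int_of_nat_eq mult_minus_left)
qed

lemma linear_tensor_expansion:
  assumes "linear (\<phi> :: 'l real_tensor \<Rightarrow> real)"
  shows "\<phi> (1 \<otimes>\<^sub>R x) = (\<Sum>j<n. of_int (f x j) * \<phi> (1 \<otimes>\<^sub>R unit j))"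
proof -
  have sum: "\<phi> (1 \<otimes>\<^sub>R sum g A) = (\<Sum>a\<in>A. \<phi> (1 \<otimes>\<^sub>R g a))" for g :: "nat \<Rightarrow> 'l" and A
    by (induction A rule: infinite_finite_induct) (auto simp: linear_tensor_simps[OF assms] linear_0[OF assms])
  show ?thesis
    by (subst coord_expansion) (simp add: sum linear_tensor_zscale[OF assms])
qed

text \<open>Write kx as x + (k - 1)x: the first summand is strictly positive and the second lies in
  X.\<close>

lemma strictly_positive_zscale:
  assumes "X \<in> Pos_sets UNIV" "x \<in> X - uminus ` X" "k > 0"
  shows "zscale k x \<in> X - uminus ` X"
proof -
  have "zscale (int m) x \<in> X" for m
    using assms by (induction m) (auto simp: zscale_Suc Pos_sets_iff)
  from strictly_positive_add[OF assms(1,2) this, of "nat (k - 1)"] assms(3) show ?thesis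
    using zscale_Suc[of "k - 1" x] by simp
qed

text \<open>Integer approximation: \<open>N l + m a\<close> is positive for \<open>\<phi>\<close> as soon as \<open>m > - N \<phi>(l) / \<phi>(a)\<close>, and
  choosing the least such \<open>m\<close> bounds \<open>\<psi>(l)\<close> below by \<open>c \<phi>(l) - c \<phi>(a) / N\<close>.\<close>

lemma nonneg_on_Pos_plus_imp_multiple:
  fixes \<phi> \<psi> :: "'l real_tensor \<Rightarrow> real"
  assumes \<phi>: "linear \<phi>" "\<phi> \<noteq> (\<lambda>_. 0)" and \<psi>: "linear \<psi>"
    and nonneg: "\<And>l. l \<in> Pos_plus \<phi> \<Longrightarrow> 0 \<le> \<psi> (1 \<otimes>\<^sub>R l)"
  obtains c where "c \<ge> 0" "\<psi> = (\<lambda>v. c * \<phi> v)"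
proof -
  obtain a where a: "a \<in> Pos_plus \<phi>" using Pos_plus_nonempty[OF \<phi>] .
  define p q where "p = \<phi> (1 \<otimes>\<^sub>R a)" and "q = \<psi> (1 \<otimes>\<^sub>R a)"
  have p: "p > 0" using a by (simp add: p_def Pos_plus_def)
  have q: "q \<ge> 0" using nonneg[OF a] by (simp add: q_def)
  \<comment> \<open>Evaluation at a leaves q / p as the only possible factor. One inequality for all
    l suffices, because it can be applied to -l as well.\<close>
  have ge: "q / p * \<phi> (1 \<otimes>\<^sub>R l) \<le> \<psi> (1 \<otimes>\<^sub>R l)" for l
  proof -
    define s t where "s = \<phi> (1 \<otimes>\<^sub>R l)" and "t = \<psi> (1 \<otimes>\<^sub>R l)"
    have bound: "real N * (q / p * s - t) \<le> q" for N :: nat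
    proof -
      define m where "m = \<lfloor>- (real N * s / p)\<rfloor> + 1"
      have m: "- (real N * s / p) < of_int m" "of_int m \<le> - (real N * s / p) + 1"
        unfolding m_def by linarith+
      have "0 < real N * s + of_int m * p"
        using m(1) p by (simp add: field_simps)
      then have "zscale (int N) l + zscale m a \<in> Pos_plus \<phi>"
        using \<phi>(1) by (simp add: Pos_plus_def linear_tensor_simps linear_tensor_zscale s_def p_def)
      from nonneg[OF this] have "0 \<le> real N * t + of_int m * q"
        using \<psi> by (simp add: linear_tensor_simps linear_tensor_zscale t_def q_def)
      also have "\<dots> \<le> real N * t + (- (real N * s / p) + 1) * q"
        using m(2) q by (intro add_left_mono mult_right_mono)
      finally show ?thesis by (simp add: algebra_simps)
    qed
    have "q / p * s - t \<le> 0"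
    proof (rule ccontr)
      assume "\<not> q / p * s - t \<le> 0"
      then obtain N :: nat where "q < real N * (q / p * s - t)"
        using ex_less_of_nat_mult[of "q / p * s - t" q] by auto
      with bound[of N] show False by simp
    qed
    then show ?thesis by (simp add: s_def t_def)
  qed
  have "\<psi> (1 \<otimes>\<^sub>R l) = q / p * \<phi> (1 \<otimes>\<^sub>R l)" for l
    using ge[of l] ge[of "- l"] \<phi>(1) \<psi> by (simp add: linear_tensor_simps)
  then have "\<psi> = (\<lambda>v. q / p * \<phi> v)"
    using \<phi>(1) \<psi> by (intro linear_tensor_ext linear_scaled)
  with that[of "q / p"] p q show thesis by simp
qed

text \<open>Fourier--Motzkin elimination of the last coordinate: replacing the elements of \<open>F\<close> with
  nonzero \<open>k\<close>-th coordinate by positive combinations of those of opposite sign keeps \<open>F\<close> strictly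
  positive, and a form that is positive on the reduced set can be corrected by a multiple of the
  \<open>k\<close>-th coordinate form.\<close>

lemma ex_positive_form_aux:
  assumes X: "X \<in> Pos_sets UNIV"
    and "finite F" "F \<subseteq> X - uminus ` X" "\<And>l i. l \<in> F \<Longrightarrow> i \<ge> k \<Longrightarrow> f l i = 0"
  shows "\<exists>\<phi> :: 'l real_tensor \<Rightarrow> real. linear \<phi> \<and> F \<subseteq> Pos_plus \<phi>"
  using assms(2-)
proof (induction k arbitrary: F)
  case 0
  \<comment> \<open>With all coordinates zero, the only candidate is 0, which is not strictly
    positive; so \<open>F\<close> is empty and any form works.\<close>
  have "l = 0" if "l \<in> F" for l using 0(3)[OF that] by (intro coord_eqI) simp
  moreover have "0 \<notin> F" using 0(2) X by (auto simp: Pos_sets_iff)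
  ultimately have "F = {}" by blast
  then show ?case using linear_zero_form by blast
next
  case (Suc k)
  define Fp Fm F0 where "Fp = {l \<in> F. f l k > 0}" and "Fm = {l \<in> F. f l k < 0}"
    and "F0 = {l \<in> F. f l k = 0}"
  \<comment> \<open>Both coefficients are positive, and they cancel the \<open>k\<close>-th
    coordinate.\<close>
  define comb where "comb = (\<lambda>(p, q). zscale (- f q k) p + zscale (f p k) q)"
  define F' where "F' = F0 \<union> comb ` (Fp \<times> Fm)"
  have fin: "finite Fp" "finite Fm" "finite F0"
    using Suc.prems(1) by (auto simp: Fp_def Fm_def F0_def)
  have comb: "comb (p, q) \<in> X - uminus ` X" if "p \<in> Fp" "q \<in> Fm" for p q
  proof -
    have "p \<in> X - uminus ` X" "q \<in> X - uminus ` X" "f p k > 0" "- f q k > 0"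
      using that Suc.prems(2) unfolding Fp_def Fm_def by auto
    then have z: "zscale (- f q k) p \<in> X - uminus ` X" "zscale (f p k) q \<in> X - uminus ` X"
      using strictly_positive_zscale[OF X] by blast+
    show ?thesis
      unfolding comb_def prod.case by (rule strictly_positive_add[OF X z(1) DiffD1[OF z(2)]])
  qed
  have "F' \<subseteq> X - uminus ` X"
  proof
    fix l assume "l \<in> F'"
    then consider "l \<in> F" | p q where "p \<in> Fp" "q \<in> Fm" "l = comb (p, q)"
      unfolding F'_def F0_def by blast
    then show "l \<in> X - uminus ` X"
    proof cases
      case 1
      then show ?thesis using Suc.prems(2) by (rule subsetD[rotated])
    next
      case 2
      show ?thesis unfolding 2(3) by (rule comb[OF 2(1,2)])
    qed
  qed
  moreover have "f l i = 0" if "l \<in> F'" "i \<ge> k" for l i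
  proof -
    have "f m i = 0" if "m \<in> F" "i \<noteq> k" for m
      using Suc.prems(3)[OF that(1), of i] that(2) \<open>i \<ge> k\<close> by simp
    then show ?thesis using that(1)
      by (cases "i = k") (auto simp: F'_def F0_def Fp_def Fm_def comb_def add)
  qed
  moreover have "finite F'" using fin by (simp add: F'_def)
  ultimately obtain \<phi> :: "'l real_tensor \<Rightarrow> real" where \<phi>: "linear \<phi>" "F' \<subseteq> Pos_plus \<phi>"
    using Suc.IH by blast
  obtain \<kappa> :: "'l real_tensor \<Rightarrow> real" where \<kappa>: "linear \<kappa>" "\<And>l. \<kappa> (1 \<otimes>\<^sub>R l) = of_int (f l k)"
    using ex_linear_tensor[of "\<lambda>l. of_int (f l k)"] by (auto simp: add)
  \<comment> \<open>The form \<phi> + t\<kappa> vanishes at l exactly for t = \<open>g l\<close>.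
    Positivity on \<open>Fp\<close> asks for t above these values, on \<open>Fm\<close> for t below
    them.\<close>
  define g where "g l = - \<phi> (1 \<otimes>\<^sub>R l) / of_int (f l k)" for l
  have "g p < g q" if "p \<in> Fp" "q \<in> Fm" for p q
  proof -
    have "comb (p, q) \<in> Pos_plus \<phi>" using \<phi>(2) that by (auto simp: F'_def)
    \<comment> \<open>Dividing this by the positive product of \<open>f p k\<close> and
      \<open>- f q k\<close> gives \<open>g p < g q\<close>.\<close>
    then have "0 < - of_int (f q k) * \<phi> (1 \<otimes>\<^sub>R p) + of_int (f p k) * \<phi> (1 \<otimes>\<^sub>R q)"
      using \<phi>(1) by (simp add: Pos_plus_def comb_def linear_tensor_simps linear_tensor_zscale)
    moreover have "real_of_int (f p k) > 0" "real_of_int (f q k) < 0"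
      using that by (auto simp: Fp_def Fm_def)
    ultimately show ?thesis by (simp add: g_def field_simps)
  qed
  then have "\<exists>t. (\<forall>a\<in>g ` Fp. a < t) \<and> (\<forall>b\<in>g ` Fm. t < b)"
    using fin by (intro ex_between_finite) auto
  then obtain t where t: "\<And>p. p \<in> Fp \<Longrightarrow> g p < t" "\<And>q. q \<in> Fm \<Longrightarrow> t < g q"
    by auto
  define \<psi> where "\<psi> v = \<phi> v + t * \<kappa> v" for v
  have "linear \<psi>"
    unfolding \<psi>_def using \<phi>(1) \<kappa>(1) by (intro linear_compose_add linear_scaled)
  moreover have "\<psi> (1 \<otimes>\<^sub>R l) > 0" if "l \<in> F" for l
  proof -
    consider "l \<in> Fp" | "l \<in> Fm" | "l \<in> F0"
      using \<open>l \<in> F\<close> by (fastforce simp: Fp_def Fm_def F0_def)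
    then show ?thesis
    proof cases
      case 1
      with t(1)[OF 1] show ?thesis by (simp add: \<psi>_def \<kappa> g_def Fp_def field_simps)
    next
      case 2
      with t(2)[OF 2] show ?thesis by (simp add: \<psi>_def \<kappa> g_def Fm_def field_simps)
    next
      case 3
      then have "l \<in> Pos_plus \<phi>" using \<phi>(2) by (auto simp: F'_def)
      with 3 show ?thesis by (simp add: \<psi>_def \<kappa> Pos_plus_def F0_def)
    qed
  qed
  ultimately show ?case by (auto simp: Pos_plus_def)
qed

text \<open>Elimination starts at \<open>k = n\<close>, where the condition on the coordinates holds
  automatically.\<close>

lemma ex_positive_form:
  assumes "X \<in> Pos_sets UNIV" "finite F" "F \<subseteq> X - uminus ` X"
  obtains \<phi> :: "'l real_tensor \<Rightarrow> real" where "linear \<phi>" "F \<subseteq> Pos_plus \<phi>"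
  using ex_positive_form_aux[OF assms, of n] by auto

subsection \<open>A compact set of representatives of the nonzero rays\<close>

text \<open>Sup-norm 1 on the basis is written as a bound attained at some index: finitely many
  closed conditions, which together exclude the zero form.\<close>

definition unit_forms :: "('l real_tensor \<Rightarrow> real) set" where
  "unit_forms = {\<psi>. linear \<psi> \<and> (\<forall>i<n. \<bar>\<psi> (1 \<otimes>\<^sub>R unit i)\<bar> \<le> 1) \<and> (\<exists>i<n. \<bar>\<psi> (1 \<otimes>\<^sub>R unit i)\<bar> = 1)}"

lemma unit_formsD:
  assumes "\<psi> \<in> unit_forms" shows "linear \<psi>" "\<psi> \<noteq> (\<lambda>_. 0)"
  using assms by (auto simp: unit_forms_def)

lemma ex_scaled_unit_form:
  assumes "linear \<psi>" "\<psi> \<noteq> (\<lambda>_. 0)"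
  obtains c where "c > 0" "(\<lambda>v. c * \<psi> v) \<in> unit_forms"
proof -
  \<comment> \<open>Scaling by 1/M normalises the form; M is positive because a form vanishing on
    the basis is zero.\<close>
  define M where "M = Max ((\<lambda>i. \<bar>\<psi> (1 \<otimes>\<^sub>R unit i)\<bar>) ` {..<n})"
  have "\<exists>i<n. \<psi> (1 \<otimes>\<^sub>R unit i) \<noteq> 0"
  proof (rule ccontr)
    assume "\<not> ?thesis"
    then have "\<psi> (1 \<otimes>\<^sub>R l) = 0" for l
      using linear_tensor_expansion[OF assms(1), of l] by simp
    then show False
      using linear_tensor_ext[OF assms(1) linear_zero_form] assms(2) by blast
  qed
  then obtain j where j: "j < n" "\<psi> (1 \<otimes>\<^sub>R unit j) \<noteq> 0" by blast
  have le: "\<bar>\<psi> (1 \<otimes>\<^sub>R unit i)\<bar> \<le> M" if "i < n" for i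
    unfolding M_def using that by (intro Max_ge) auto
  have "M > 0" using le[OF j(1)] j(2) by linarith
  have "M \<in> (\<lambda>i. \<bar>\<psi> (1 \<otimes>\<^sub>R unit i)\<bar>) ` {..<n}"
    unfolding M_def using j(1) by (intro Max_in) auto
  then obtain i where "i < n" "\<bar>\<psi> (1 \<otimes>\<^sub>R unit i)\<bar> = M" by auto
  with le \<open>M > 0\<close> have "(\<lambda>v. inverse M * \<psi> v) \<in> unit_forms"
    using linear_scaled[OF assms(1), of "inverse M"]
    by (auto simp: unit_forms_def abs_mult mult.commute[of "inverse M"] pos_divide_le_eq
        simp flip: divide_inverse intro!: exI[of _ i])
  with \<open>M > 0\<close> that[of "inverse M"] show thesis by simp
qed

text \<open>On a pure tensor the coordinate expansion bounds all unit forms at once, and bounds add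
  up under differences.\<close>

lemma unit_forms_bounded:
  "\<exists>C. \<forall>\<psi>\<in>unit_forms. \<bar>\<psi> v\<bar> \<le> C"
proof (induction v rule: real_tensor_induct)
  case zero
  then show ?case using unit_formsD(1) linear_0 by (intro exI[of _ 0]) fastforce
next
  case (diff u v)
  then obtain C D where "\<forall>\<psi>\<in>unit_forms. \<bar>\<psi> u\<bar> \<le> C" "\<forall>\<psi>\<in>unit_forms. \<bar>\<psi> v\<bar> \<le> D" by blast
  then have "\<bar>\<psi> (u - v)\<bar> \<le> C + D" if "\<psi> \<in> unit_forms" for \<psi>
    using that linear_diff[OF unit_formsD(1)[OF that], of u v] by (smt (verit) real_norm_def)
  then show ?case by blast
next
  case (tensor r a)
  have "\<bar>\<psi> (r \<otimes>\<^sub>R a)\<bar> \<le> \<bar>r\<bar> * (\<Sum>j<n. of_int \<bar>f a j\<bar>)" if "\<psi> \<in> unit_forms" for \<psi>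
  proof -
    have lin: "linear \<psi>" using that by (rule unit_formsD)
    have "\<bar>\<psi> (1 \<otimes>\<^sub>R a)\<bar> \<le> (\<Sum>j<n. \<bar>of_int (f a j) * \<psi> (1 \<otimes>\<^sub>R unit j)\<bar>)"
      unfolding linear_tensor_expansion[OF lin, of a] by (rule sum_abs)
    also have "\<dots> \<le> (\<Sum>j<n. of_int \<bar>f a j\<bar>)"
      using that by (intro sum_mono) (auto simp: abs_mult unit_forms_def intro!: mult_left_le)
    finally show ?thesis
      by (subst tensor_eq_scaleR) (simp add: linear_scale[OF lin] abs_mult mult_left_mono)
  qed
  then show ?case by blast
qed

text \<open>By Tychonoff, the product over all tensors v of the intervals from -C(v) to C(v) is
  compact; the unit forms are a closed subset of it.\<close>

lemma compact_unit_forms: "compact unit_forms"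
proof -
  obtain C where C: "\<And>v \<psi>. \<psi> \<in> unit_forms \<Longrightarrow> \<bar>\<psi> v\<bar> \<le> C v"
    using unit_forms_bounded by metis
  have "compact (PiE UNIV (\<lambda>v :: 'l real_tensor. {- C v..C v}))"
    using compactin_PiE[of "\<lambda>_. euclidean" UNIV "\<lambda>v :: 'l real_tensor. {- C v..C v}"]
    by (simp add: euclidean_product_topology)
  moreover have "closed unit_forms"
  proof -
    have "unit_forms = dual \<inter> ((\<Inter>i\<in>{..<n}. {\<psi>. \<bar>\<psi> (1 \<otimes>\<^sub>R unit i)\<bar> \<le> 1}) \<inter>
        (\<Union>i\<in>{..<n}. {\<psi>. \<bar>\<psi> (1 \<otimes>\<^sub>R unit i)\<bar> = 1}))"
      by (auto simp: unit_forms_def dual_def)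
    also have "closed \<dots>"
      by (intro closed_Int closed_dual closed_INT closed_UN ballI finite_lessThan
          closed_Collect_le closed_Collect_eq continuous_intros continuous_on_product_coordinates)
    finally show ?thesis .
  qed
  moreover have "unit_forms \<subseteq> PiE UNIV (\<lambda>v. {- C v..C v})"
    using C by (auto simp: PiE_def abs_le_iff)  (metis C abs_le_iff minus_le_iff)
  ultimately show ?thesis by (metis compact_Int_closed inf.absorb_iff2)
qed

text \<open>Compactness turns forms that are positive on finite subsets into one that is nonnegative on
  all of \<open>X\<close>.\<close>

lemma ex_supporting_form:
  assumes X: "X \<in> Pos_sets UNIV" "X \<noteq> UNIV"
  obtains \<phi> :: "'l real_tensor \<Rightarrow> real" where "linear \<phi>" "\<phi> \<noteq> (\<lambda>_. 0)" "X \<subseteq> Pos \<phi>"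
proof -
  define P where "P = X - uminus ` X"
  define H where "H l = {\<psi> :: 'l real_tensor \<Rightarrow> real. 0 \<le> \<psi> (1 \<otimes>\<^sub>R l)}" for l
  obtain a where a: "a \<in> P" using strictly_positive_nonempty[OF X] unfolding P_def .
  have "unit_forms \<inter> (\<Inter>l\<in>P. H l) \<noteq> {}"
  proof (rule compact_imp_fip_image[OF compact_unit_forms])
    show "closed (H l)" for l
      unfolding H_def by (intro closed_Collect_le continuous_intros continuous_on_product_coordinates)
    fix F assume F: "finite F" "F \<subseteq> P"
    \<comment> \<open>Including \<open>a\<close> makes the form nonzero even when \<open>F\<close>
      is empty, so that it can be normalised.\<close>
    then obtain \<psi> :: "'l real_tensor \<Rightarrow> real" where \<psi>: "linear \<psi>" "insert a F \<subseteq> Pos_plus \<psi>"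
      using ex_positive_form[OF X(1), of "insert a F"] a unfolding P_def by auto
    then have "\<psi> \<noteq> (\<lambda>_. 0)" by (auto simp: Pos_plus_def)
    then obtain c where c: "c > 0" "(\<lambda>v. c * \<psi> v) \<in> unit_forms"
      using ex_scaled_unit_form \<psi>(1) by blast
    have "(\<lambda>v. c * \<psi> v) \<in> (\<Inter>l\<in>F. H l)"
      using c \<psi>(2) by (auto simp: H_def Pos_plus_def)
    with c(2) show "unit_forms \<inter> (\<Inter>l\<in>F. H l) \<noteq> {}" by blast
  qed
  then obtain \<psi> where "\<psi> \<in> unit_forms" and \<psi>: "\<And>l. l \<in> P \<Longrightarrow> 0 \<le> \<psi> (1 \<otimes>\<^sub>R l)"
    by (auto simp: H_def)
  note lin = unit_formsD[OF this(1)]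
  \<comment> \<open>This extends nonnegativity from X* to X: a + ml stays in X* for every m, and a
    negative value at l would make its value negative for large m.\<close>
  have "0 \<le> \<psi> (1 \<otimes>\<^sub>R l)" if l: "l \<in> X" for l
  proof (rule ccontr)
    assume "\<not> ?thesis"
    then obtain m :: nat where "\<psi> (1 \<otimes>\<^sub>R a) < real m * - \<psi> (1 \<otimes>\<^sub>R l)"
      using ex_less_of_nat_mult[of "- \<psi> (1 \<otimes>\<^sub>R l)" "\<psi> (1 \<otimes>\<^sub>R a)"] by auto
    moreover have "zscale (int m) l \<in> X" for m
      using l X(1) by (induction m) (auto simp: zscale_Suc Pos_sets_iff)
    then have "a + zscale (int m) l \<in> P" for m
      using strictly_positive_add[OF X(1)] a by (simp add: P_def)
    from \<psi>[OF this, of m] have "0 \<le> \<psi> (1 \<otimes>\<^sub>R a) + real m * \<psi> (1 \<otimes>\<^sub>R l)"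
      by (simp add: linear_tensor_simps linear_tensor_zscale lin)
    ultimately show False by simp
  qed
  then show thesis using that[OF lin] by (auto simp: Pos_def)
qed

end


section \<open>Rays\<close>

lemma ray_eq_iff:
  assumes "linear \<phi>" "linear \<psi>"
  shows "ray \<phi> = ray \<psi> \<longleftrightarrow> (\<exists>c>0. \<psi> = (\<lambda>v. c * \<phi> v))"
  unfolding ray_def using assms eq_equiv_class_iff[OF equiv_pos_scaling, of \<phi> \<psi>]
  by (auto simp: dual_def pos_scaling_def)

lemma topspace_ray_topology: "topspace ray_topology = ray ` dual"
  by (auto simp: ray_topology_def dual_topology_def quotient_def ray_def)

lemma openin_ray_topology:
  fixes U :: "('v::real_vector \<Rightarrow> real) set set"
  shows "openin ray_topology U \<longleftrightarrow> U \<subseteq> ray ` dual \<and> openin (top_of_set dual) {\<phi> \<in> dual. ray \<phi> \<in> U}"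
proof -
  have "dual // pos_scaling = (ray ` dual :: ('v \<Rightarrow> real) set set)" by (auto simp: quotient_def ray_def)
  then show ?thesis
    by (simp add: ray_topology_def openin_quotient_topology dual_topology_def flip: ray_def)
qed

text \<open>Small positive multiples of \<psi> approach 0 but stay on the ray of \<psi>. Hence the
  only open neighbourhood of the zero ray is the whole space.\<close>

lemma ray_mem_openin_zero:
  assumes U: "openin ray_topology U" "ray (\<lambda>_. 0) \<in> U" and \<psi>: "linear \<psi>"
  shows "ray \<psi> \<in> U"
proof -
  obtain T where T: "open T" "{\<phi> \<in> dual. ray \<phi> \<in> U} = dual \<inter> T"
    using U(1) by (auto simp: openin_ray_topology openin_open)
  define s where "s c = (\<lambda>v. c * \<psi> v)" for c :: real
  have "continuous_on UNIV s"
    unfolding s_def by (intro continuous_on_coordinatewise_then_product continuous_intros)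
  then have "open (s -` T)" using T(1) open_vimage by blast
  moreover have "0 \<in> s -` T"
    using T(2) U(2) linear_zero_form by (auto simp: s_def dual_def)
  ultimately obtain e where e: "e > 0" "ball 0 e \<subseteq> s -` T" by (meson open_contains_ball)
  then have "e / 2 \<in> s -` T" by (intro subsetD[OF e(2)]) simp
  moreover have "s (e / 2) \<in> dual"
    unfolding s_def dual_def using linear_scaled[OF \<psi>] by blast
  ultimately have "s (e / 2) \<in> dual \<inter> T" by simp
  then have "ray (s (e / 2)) \<in> U" using T(2) by blast
  moreover have "ray \<psi> = ray (s (e / 2))"
    using ray_eq_iff[OF \<psi> linear_scaled[OF \<psi>]] half_gt_zero[OF e(1)]
    unfolding s_def by blast
  ultimately show ?thesis by simp
qed

section \<open>Continuity of the map from rays to positive subsets\<close>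

lemma openin_Pos_topologyE:
  assumes "openin (Pos_topology L) U" "X \<in> U"
  obtains E where "finite E" "E \<subseteq> L" "X \<in> avoiding L E" "avoiding L E \<subseteq> U"
  using assms unfolding openin_Pos_topology by meson

text \<open>Pos \<phi> avoids a finite set E exactly if \<phi> is negative on E. These are finitely
  many strict inequalities, hence an open condition on the dual, where openness of a set of rays is
  tested.\<close>

lemma continuous_map_Pos_bar: "continuous_map ray_topology (Pos_topology UNIV) Pos_bar"
  unfolding continuous_map
proof (intro conjI allI impI)
  show "Pos_bar ` topspace ray_topology \<subseteq> topspace (Pos_topology UNIV)"
    by (auto simp: topspace_ray_topology dual_def Pos_bar_ray Pos_in_Pos_sets)
  fix U :: "'a set set" assume U: "openin (Pos_topology UNIV) U"
  have *: "{\<phi> \<in> dual. Pos \<phi> \<in> U} = dual \<inter> (\<Union>E\<in>{E. finite E \<and> avoiding UNIV E \<subseteq> U}.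
      \<Inter>l\<in>E. {\<phi>. \<phi> (1 \<otimes>\<^sub>R l) < 0})" (is "?L = ?R")
  proof
    show "?L \<subseteq> ?R"
    proof
      fix \<phi> assume \<phi>: "\<phi> \<in> ?L"
      then obtain E where "finite E" "Pos \<phi> \<in> avoiding UNIV E" "avoiding UNIV E \<subseteq> U"
        using openin_Pos_topologyE[OF U, of "Pos \<phi>"] by auto
      moreover from this have "\<forall>l\<in>E. \<phi> (1 \<otimes>\<^sub>R l) < 0"
        by (fastforce simp: avoiding_def Pos_def not_le)
      ultimately show "\<phi> \<in> ?R" using \<phi> by blast
    qed
    show "?R \<subseteq> ?L"
    proof
      fix \<phi> assume "\<phi> \<in> ?R"
      then obtain E where E: "avoiding UNIV E \<subseteq> U" "\<forall>l\<in>E. \<phi> (1 \<otimes>\<^sub>R l) < 0" and "\<phi> \<in> dual"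
        by blast
      then have "Pos \<phi> \<in> avoiding UNIV E"
        using Pos_in_Pos_sets[of \<phi>] by (auto simp: avoiding_def dual_def Pos_def)
      with E(1) \<open>\<phi> \<in> dual\<close> show "\<phi> \<in> ?L" by blast
    qed
  qed
  have "open (\<Union>E\<in>{E. finite E \<and> avoiding UNIV E \<subseteq> U}.
      \<Inter>l\<in>E. {\<phi>. \<phi> (1 \<otimes>\<^sub>R l) < (0 :: real)})"
    by (intro open_UN ballI open_INT open_Collect_less continuous_intros
        continuous_on_product_coordinates) auto
  then have "openin (top_of_set dual) {\<phi> \<in> dual. Pos \<phi> \<in> U}"
    unfolding * by (rule openin_open_Int)
  moreover have "{\<phi> \<in> dual. ray \<phi> \<in> {c \<in> topspace ray_topology. Pos_bar c \<in> U}} =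
      {\<phi> \<in> dual. Pos \<phi> \<in> U}"
    by (auto simp: topspace_ray_topology dual_def Pos_bar_ray)
  ultimately have "openin (top_of_set dual)
      {\<phi> \<in> dual. ray \<phi> \<in> {c \<in> topspace ray_topology. Pos_bar c \<in> U}}"
    by (simp only:)
  then show "openin ray_topology {c \<in> topspace ray_topology. Pos_bar c \<in> U}"
    unfolding openin_ray_topology topspace_ray_topology by blast
qed


section \<open>The fibration of positive subsets over rays\<close>

context lattice_coordinates
begin

text \<open>This justifies the definite description in \<open>ray_of\<close>: a second supporting
  form is nonnegative on X, which contains Pos+ \<phi>, and so is a positive multiple of
  \<phi>.\<close>

lemma ray_of_eqI:
  fixes \<phi> :: "'l real_tensor \<Rightarrow> real"
  assumes X: "X \<in> Pos_sets UNIV" and \<phi>: "linear \<phi>" "\<phi> \<noteq> (\<lambda>_. 0)" "X \<subseteq> Pos \<phi>"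
  shows "ray_of X = ray \<phi>"
proof -
  have "X \<noteq> UNIV" using \<phi> Pos_neq_UNIV by blast
  moreover have "ray \<psi> = ray \<phi>" if \<psi>: "linear \<psi>" "\<psi> \<noteq> (\<lambda>_. 0)" "X \<subseteq> Pos \<psi>" for \<psi>
  proof -
    have "0 \<le> \<psi> (1 \<otimes>\<^sub>R l)" if "l \<in> Pos_plus \<phi>" for l
      using that Pos_plus_subset[OF X \<phi>(1,3)] \<psi>(3) by (auto simp: Pos_def)
    then obtain c where "c \<ge> 0" "\<psi> = (\<lambda>v. c * \<phi> v)"
      using nonneg_on_Pos_plus_imp_multiple[OF \<phi>(1,2) \<psi>(1)] by blast
    moreover from this have "c \<noteq> 0" using \<psi>(2) by auto
    ultimately show ?thesis
      using ray_eq_iff[OF \<phi>(1) \<psi>(1)] by (metis less_eq_real_def)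
  qed
  moreover have "(THE c. \<exists>\<psi>. linear \<psi> \<and> \<psi> \<noteq> (\<lambda>_. 0) \<and> X \<subseteq> Pos \<psi> \<and> c = ray \<psi>) = ray \<phi>"
    using \<phi> calculation(2) by (intro the_equality) blast+
  ultimately show ?thesis by (simp add: ray_of_def)
qed

lemma ray_of_Pos:
  fixes \<phi> :: "'l real_tensor \<Rightarrow> real"
  assumes "linear \<phi>"
  shows "ray_of (Pos \<phi>) = ray \<phi>"
proof (cases "\<phi> = (\<lambda>_. 0)")
  case True
  then have "Pos \<phi> = UNIV" by (auto simp: Pos_def)
  with True show ?thesis by (simp add: ray_of_def)
qed (use assms in \<open>simp add: ray_of_eqI Pos_in_Pos_sets\<close>)

lemma ray_zero_eq_iff:
  assumes "linear \<phi>" shows "ray (\<lambda>_. 0) = ray \<phi> \<longleftrightarrow> \<phi> = (\<lambda>_. 0)"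
proof -
  have "ray (\<lambda>_. 0) = ray \<phi> \<longleftrightarrow> (\<exists>c>0 :: real. \<phi> = (\<lambda>_. 0))"
    unfolding ray_eq_iff[OF linear_zero_form assms] by simp
  then show ?thesis using zero_less_one by blast
qed

lemma ray_of_eq_iff:
  fixes \<phi> :: "'l real_tensor \<Rightarrow> real"
  assumes X: "X \<in> Pos_sets UNIV" and \<phi>: "linear \<phi>" "\<phi> \<noteq> (\<lambda>_. 0)"
  shows "ray_of X = ray \<phi> \<longleftrightarrow> X \<subseteq> Pos \<phi>"
proof
  assume *: "ray_of X = ray \<phi>"
  then have "X \<noteq> UNIV" using ray_zero_eq_iff[OF \<phi>(1)] \<phi>(2) unfolding ray_of_def by metis
  then obtain \<psi> :: "'l real_tensor \<Rightarrow> real" where \<psi>: "linear \<psi>" "\<psi> \<noteq> (\<lambda>_. 0)" "X \<subseteq> Pos \<psi>"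
    using ex_supporting_form[OF X] by blast
  then have "ray \<psi> = ray \<phi>" using ray_of_eqI[OF X] * by simp
  \<comment> \<open>\<open>Pos_bar\<close> recovers the half-lattice from the ray alone.\<close>
  then have "Pos \<psi> = Pos \<phi>" using Pos_bar_ray \<psi>(1) \<phi>(1) by metis
  with \<psi>(3) show "X \<subseteq> Pos \<phi>" by simp
qed (use assms ray_of_eqI in blast)

lemma ray_fibre_ray:
  fixes \<phi> :: "'l real_tensor \<Rightarrow> real"
  assumes "linear \<phi>" "\<phi> \<noteq> (\<lambda>_. 0)"
  shows "ray_fibre (ray \<phi>) = {X \<in> Pos_sets UNIV. X \<subseteq> Pos \<phi>}"
  using ray_of_eq_iff[OF _ assms] unfolding ray_fibre_def by blast

text \<open>By compactness of the unit forms, finitely many strict inequalities valid for \<open>\<phi>\<close> suffice to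
  force the ray of a form into a given neighbourhood of the ray of \<open>\<phi>\<close>.\<close>

lemma continuous_map_ray_of:
  "continuous_map (Pos_topology UNIV) ray_topology (ray_of :: 'l set \<Rightarrow> _)"
  unfolding continuous_map
proof (intro conjI allI impI)
  show "ray_of ` topspace (Pos_topology (UNIV :: 'l set)) \<subseteq> topspace ray_topology"
  proof
    fix c assume "c \<in> ray_of ` topspace (Pos_topology (UNIV :: 'l set))"
    then obtain X :: "'l set" where X: "X \<in> Pos_sets UNIV" "c = ray_of X" by auto
    show "c \<in> topspace ray_topology"
    proof (cases "X = UNIV")
      case True
      then show ?thesis
        using X linear_zero_form by (auto simp: ray_of_def topspace_ray_topology dual_def)
    next
      case False
      then obtain \<psi> :: "'l real_tensor \<Rightarrow> real" where "linear \<psi>" "\<psi> \<noteq> (\<lambda>_. 0)" "X \<subseteq> Pos \<psi>"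
        using ex_supporting_form[OF X(1)] by blast
      then show ?thesis using X ray_of_eqI by (auto simp: topspace_ray_topology dual_def)
    qed
  qed
  fix U :: "('l real_tensor \<Rightarrow> real) set set" assume U: "openin ray_topology U"
  let ?V = "{X \<in> Pos_sets UNIV. ray_of X \<in> U}"
  have "\<exists>E. finite E \<and> X \<in> avoiding UNIV E \<and> avoiding UNIV E \<subseteq> ?V"
    if X: "X \<in> Pos_sets UNIV" "ray_of X \<in> U" for X
  proof (cases "X = UNIV")
    case True
    then have zero: "ray (\<lambda>_. 0) \<in> U" using X by (simp add: ray_of_def)
    have "ray_of Y \<in> U" if Y: "Y \<in> Pos_sets UNIV" for Y
    proof (cases "Y = UNIV")
      case False
      then obtain \<psi> :: "'l real_tensor \<Rightarrow> real" where "linear \<psi>" "\<psi> \<noteq> (\<lambda>_. 0)" "Y \<subseteq> Pos \<psi>"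
        using ex_supporting_form[OF Y] by blast
      then show ?thesis using ray_of_eqI[OF Y] ray_mem_openin_zero[OF U zero] by simp
    qed (simp add: ray_of_def zero)
    \<comment> \<open>The whole lattice avoids only the empty set, so every positive subset has to
      map into \<open>U\<close>; this holds because \<open>U\<close> contains the zero ray.\<close>
    then show ?thesis using X(1) by (intro exI[of _ "{}"]) (auto simp: avoiding_def)
  next
    case False
    then obtain \<phi> :: "'l real_tensor \<Rightarrow> real" where \<phi>: "linear \<phi>" "\<phi> \<noteq> (\<lambda>_. 0)" "X \<subseteq> Pos \<phi>"
      using ex_supporting_form[OF X(1)] by blast
    then have "ray \<phi> \<in> U" using X ray_of_eqI by simp
    obtain a where a: "a \<in> Pos_plus \<phi>" using Pos_plus_nonempty[OF \<phi>(1,2)] .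
    obtain T where T: "open T" "{\<psi> \<in> dual. ray \<psi> \<in> U} = dual \<inter> T"
      using U by (auto simp: openin_ray_topology openin_open)
    have "compact (unit_forms - T)" using compact_unit_forms T(1) by (rule compact_diff)
    moreover have "open {\<psi>. \<psi> (1 \<otimes>\<^sub>R l) < (0 :: real)}" for l :: 'l
      by (intro open_Collect_less continuous_intros continuous_on_product_coordinates)
    \<comment> \<open>A unit form that is nonnegative on all of Pos+ \<phi> is a positive multiple
      of \<phi>, so its ray is in \<open>U\<close> and the form is in \<open>T\<close>.\<close>
    moreover have "unit_forms - T \<subseteq> (\<Union>l\<in>Pos_plus \<phi>. {\<psi>. \<psi> (1 \<otimes>\<^sub>R l) < 0})"
    proof
      fix \<psi> assume \<psi>: "\<psi> \<in> unit_forms - T"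
      note lin = unit_formsD[of \<psi>]
      have "\<exists>l\<in>Pos_plus \<phi>. \<psi> (1 \<otimes>\<^sub>R l) < 0"
      proof (rule ccontr)
        assume "\<not> ?thesis"
        then obtain c where "c \<ge> 0" "\<psi> = (\<lambda>v. c * \<phi> v)"
          using nonneg_on_Pos_plus_imp_multiple[OF \<phi>(1,2), of \<psi>] lin \<psi> by (auto simp: not_less)
        moreover from this have "c \<noteq> 0" using lin \<psi> by auto
        ultimately have "ray \<psi> = ray \<phi>"
          using ray_eq_iff[OF \<phi>(1), of \<psi>] lin \<psi> by (metis DiffD1 less_eq_real_def)
        then have "\<psi> \<in> dual \<inter> T" using \<open>ray \<phi> \<in> U\<close> lin \<psi> T(2) by (auto simp: dual_def)
        with \<psi> show False by blast
      qed
      then show "\<psi> \<in> (\<Union>l\<in>Pos_plus \<phi>. {\<psi>. \<psi> (1 \<otimes>\<^sub>R l) < 0})" by blast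
    qed
    ultimately obtain F where F: "F \<subseteq> Pos_plus \<phi>" "finite F"
      "unit_forms - T \<subseteq> (\<Union>l\<in>F. {\<psi>. \<psi> (1 \<otimes>\<^sub>R l) < 0})"
      by (rule compactE_image)
    \<comment> \<open>Avoiding -l forces l into Y for each l in \<open>F\<close>; avoiding -a keeps
      Y proper even when \<open>F\<close> is empty.\<close>
    define E where "E = uminus ` insert a F"
    have "X \<in> avoiding UNIV E"
      using X(1) \<phi>(1,3) F(1) a
      by (force simp: avoiding_def E_def Pos_def Pos_plus_def linear_tensor_simps)
    moreover have "ray_of Y \<in> U" if "Y \<in> avoiding UNIV E" for Y
    proof -
      have Y: "Y \<in> Pos_sets UNIV" and neg: "\<And>l. l \<in> insert a F \<Longrightarrow> - l \<notin> Y"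
        using that by (auto simp: avoiding_def E_def)
      then have "F \<subseteq> Y" "Y \<noteq> UNIV" using Pos_sets_cases[OF Y] by blast+
      then obtain \<psi> :: "'l real_tensor \<Rightarrow> real" where \<psi>: "linear \<psi>" "\<psi> \<noteq> (\<lambda>_. 0)" "Y \<subseteq> Pos \<psi>"
        using ex_supporting_form[OF Y] by blast
      obtain c where c: "c > 0" "(\<lambda>v. c * \<psi> v) \<in> unit_forms"
        using ex_scaled_unit_form \<psi>(1,2) by blast
      \<comment> \<open>Nonnegativity on \<open>F\<close> places the scaled form outside every
        member of the finite cover, hence in \<open>T\<close>.\<close>
      have "\<forall>l\<in>F. 0 \<le> c * \<psi> (1 \<otimes>\<^sub>R l)"
        using c(1) \<open>F \<subseteq> Y\<close> \<psi>(3) by (auto simp: Pos_def)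
      then have "(\<lambda>v. c * \<psi> v) \<in> dual \<inter> T"
        using c(2) F(3) linear_scaled[OF \<psi>(1)] by (force simp: dual_def)
      then have "ray (\<lambda>v. c * \<psi> v) \<in> U" using T(2) by blast
      moreover have "ray \<psi> = ray (\<lambda>v. c * \<psi> v)"
        using ray_eq_iff[OF \<psi>(1) linear_scaled[OF \<psi>(1)]] c(1) by blast
      ultimately show ?thesis using ray_of_eqI[OF Y \<psi>] by simp
    qed
    moreover have "finite E" using F(2) by (simp add: E_def)
    moreover have "avoiding UNIV E \<subseteq> Pos_sets UNIV" unfolding avoiding_def by blast
    ultimately show ?thesis by blast
  qed
  then show "openin (Pos_topology UNIV) {X \<in> topspace (Pos_topology UNIV). ray_of X \<in> U}"
    unfolding openin_Pos_topology topspace_Pos_topology by blast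
qed

lemma dense_Pos_bar:
  "Pos_topology (UNIV :: 'l set) closure_of (Pos_bar ` topspace ray_topology) =
     topspace (Pos_topology UNIV)"
  unfolding dense_intersects_open
proof (intro allI impI, elim conjE)
  fix U :: "'l set set" assume U: "openin (Pos_topology UNIV) U" "U \<noteq> {}"
  from U(2) obtain X where "X \<in> U" by blast
  with U(1) obtain E where "finite E" "X \<in> avoiding UNIV E" "avoiding UNIV E \<subseteq> U"
    by (rule openin_Pos_topologyE)
  then have X: "X \<in> Pos_sets UNIV" and E: "finite E" "X \<inter> E = {}" "avoiding UNIV E \<subseteq> U"
    by (auto simp: avoiding_def)
  \<comment> \<open>Each l in \<open>E\<close> is missing from X, so -l is in X, and strictly
    so.\<close>
  have "uminus ` E \<subseteq> X - uminus ` X"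
    using E(2) Pos_sets_cases[OF X] by fastforce
  then obtain \<phi> :: "'l real_tensor \<Rightarrow> real" where \<phi>: "linear \<phi>" "uminus ` E \<subseteq> Pos_plus \<phi>"
    using ex_positive_form[OF X, of "uminus ` E"] E(1) by blast
  have "l \<notin> Pos \<phi>" if "l \<in> E" for l
  proof -
    have "- l \<in> Pos_plus \<phi>" using that \<phi>(2) by blast
    then show ?thesis by (simp add: Pos_def Pos_plus_def linear_tensor_simps[OF \<phi>(1)])
  qed
  then have "Pos \<phi> \<in> avoiding UNIV E"
    using Pos_in_Pos_sets[OF \<phi>(1)] unfolding avoiding_def by blast
  then have "Pos_bar (ray \<phi>) \<in> U" using E(3) Pos_bar_ray[OF \<phi>(1)] by auto
  then show "Pos_bar ` topspace ray_topology \<inter> U \<noteq> {}"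
    using \<phi>(1) by (auto simp: topspace_ray_topology dual_def)
qed

section \<open>Fibres over nonzero rays\<close>

text \<open>A basic neighbourhood of Pos \<phi> contains every smaller positive subset, since
  avoidance passes to subsets. Conversely, a point l of X outside Pos \<phi> gives the neighbourhood
  avoiding l, which omits X.\<close>

lemma ray_fibre_eq_Inter_neighbourhoods:
  fixes \<phi> :: "'l real_tensor \<Rightarrow> real"
  assumes \<phi>: "linear \<phi>" "\<phi> \<noteq> (\<lambda>_. 0)"
  shows "ray_fibre (ray \<phi>) = \<Inter>{N. N \<subseteq> topspace (Pos_topology UNIV) \<and>
    (\<exists>U. openin (Pos_topology UNIV) U \<and> Pos \<phi> \<in> U \<and> U \<subseteq> N)}" (is "_ = \<Inter>?N")
proof
  show "ray_fibre (ray \<phi>) \<subseteq> \<Inter>?N"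
  proof (intro subsetI InterI)
    fix X N assume X: "X \<in> ray_fibre (ray \<phi>)" and "N \<in> ?N"
    then obtain U where U: "openin (Pos_topology UNIV) U" "Pos \<phi> \<in> U" "U \<subseteq> N" by blast
    from U(1,2) obtain E where "Pos \<phi> \<in> avoiding UNIV E" "avoiding UNIV E \<subseteq> U"
      by (rule openin_Pos_topologyE)
    with \<open>U \<subseteq> N\<close> have "Pos \<phi> \<in> avoiding UNIV E" "avoiding UNIV E \<subseteq> N" by auto
    with X show "X \<in> N" by (auto simp: ray_fibre_ray[OF \<phi>] avoiding_def)
  qed
  show "\<Inter>?N \<subseteq> ray_fibre (ray \<phi>)"
  proof
    fix X assume X: "X \<in> \<Inter>?N"
    have "Pos_sets UNIV \<in> ?N"
      using Pos_in_Pos_sets[OF \<phi>(1)] openin_topspace[of "Pos_topology (UNIV :: 'l set)"] by auto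
    with X have "X \<in> Pos_sets UNIV" by blast
    moreover have "X \<subseteq> Pos \<phi>"
    proof (rule ccontr)
      assume "\<not> X \<subseteq> Pos \<phi>"
      then obtain l where l: "l \<in> X" "l \<notin> Pos \<phi>" by blast
      have "openin (Pos_topology UNIV) (avoiding UNIV {l})"
        by (auto simp: openin_Pos_topology avoiding_def)
      moreover have "Pos \<phi> \<in> avoiding UNIV {l}"
        using l Pos_in_Pos_sets[OF \<phi>(1)] by (simp add: avoiding_def)
      ultimately have "avoiding UNIV {l} \<in> ?N" by (auto simp: avoiding_def)
      with X have "X \<in> avoiding UNIV {l}" by blast
      with l(1) show False by (simp add: avoiding_def)
    qed
    ultimately show "X \<in> ray_fibre (ray \<phi>)" by (simp add: ray_fibre_ray[OF \<phi>])
  qed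
qed

text \<open>A member of the fibre lies between Pos+ \<phi> and Pos \<phi>, so it is determined by
  its trace on the kernel; intersecting with \<open>Ker \<phi>\<close> is the continuous
  inverse.\<close>

lemma homeomorphic_map_Un_Pos_plus:
  fixes \<phi> :: "'l real_tensor \<Rightarrow> real"
  assumes \<phi>: "linear \<phi>" "\<phi> \<noteq> (\<lambda>_. 0)"
  shows "homeomorphic_map (Pos_topology (Ker \<phi>))
    (subtopology (Pos_topology UNIV) (ray_fibre (ray \<phi>))) (\<lambda>X. X \<union> Pos_plus \<phi>)"
proof -
  note simps = Ker_def Pos_plus_def Pos_def linear_tensor_simps[OF \<phi>(1)] linear_0[OF \<phi>(1)]
  have Ker: "X \<subseteq> Ker \<phi>" if "X \<in> Pos_sets (Ker \<phi>)" for X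
    using that by (auto simp: Pos_sets_iff)
  have fibre: "X \<union> Pos_plus \<phi> \<in> ray_fibre (ray \<phi>)" if X: "X \<in> Pos_sets (Ker \<phi>)" for X
  proof -
    have K: "\<phi> (1 \<otimes>\<^sub>R l) = 0" if "l \<in> X" for l using Ker[OF X] that by (auto simp: Ker_def)
    have "l \<in> X \<union> Pos_plus \<phi> \<or> - l \<in> X \<union> Pos_plus \<phi>" for l
    proof (cases "l \<in> Ker \<phi>")
      case True
      then have "l \<in> X \<or> - l \<in> X" using X unfolding Pos_sets_iff by auto
      then show ?thesis by blast
    qed (auto simp: simps)
    moreover have "x + y \<in> X \<union> Pos_plus \<phi>"
      if "x \<in> X \<union> Pos_plus \<phi>" "y \<in> X \<union> Pos_plus \<phi>" for x y
      using that X K by (auto simp: simps Pos_sets_iff)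
    moreover have "0 \<in> X \<union> Pos_plus \<phi>" using X by (simp add: Pos_sets_iff)
    ultimately have "X \<union> Pos_plus \<phi> \<in> Pos_sets UNIV"
      unfolding Pos_sets_iff set_eq_iff Un_iff[of _ "X \<union> Pos_plus \<phi>"] in_uminus_image_iff
      by blast
    moreover have "X \<union> Pos_plus \<phi> \<subseteq> Pos \<phi>" using K by (auto simp: simps)
    ultimately show ?thesis by (simp add: ray_fibre_ray[OF \<phi>])
  qed
  have restrict: "Y \<inter> Ker \<phi> \<in> Pos_sets (Ker \<phi>)" if "Y \<in> Pos_sets UNIV" for Y
  proof -
    have "x \<in> Y \<or> - x \<in> Y" for x using Pos_sets_cases[OF that] .
    then show ?thesis using that by (auto simp: Pos_sets_iff simps)
  qed
  have left: "(X \<union> Pos_plus \<phi>) \<inter> Ker \<phi> = X" if "X \<in> Pos_sets (Ker \<phi>)" for X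
    using Ker[OF that] by (auto simp: simps)
  have right: "Y \<inter> Ker \<phi> \<union> Pos_plus \<phi> = Y" if "Y \<in> ray_fibre (ray \<phi>)" for Y
  proof -
    have Y: "Y \<in> Pos_sets UNIV" "Y \<subseteq> Pos \<phi>" using that by (auto simp: ray_fibre_ray[OF \<phi>])
    then show ?thesis using Pos_plus_subset[OF Y(1) \<phi>(1) Y(2)] by (force simp: simps)
  qed
  have "continuous_map (Pos_topology (Ker \<phi>)) (Pos_topology UNIV) (\<lambda>X. X \<union> Pos_plus \<phi>)"
    unfolding continuous_map
  proof (intro conjI allI impI)
    show "(\<lambda>X. X \<union> Pos_plus \<phi>) ` topspace (Pos_topology (Ker \<phi>)) \<subseteq> topspace (Pos_topology UNIV)"
      using fibre by (auto simp: ray_fibre_def)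
    fix U :: "'l set set" assume U: "openin (Pos_topology UNIV) U"
    show "openin (Pos_topology (Ker \<phi>)) {X \<in> topspace (Pos_topology (Ker \<phi>)). X \<union> Pos_plus \<phi> \<in> U}"
      unfolding openin_Pos_topology
    proof (intro conjI ballI)
      fix X assume "X \<in> {X \<in> topspace (Pos_topology (Ker \<phi>)). X \<union> Pos_plus \<phi> \<in> U}"
      then have X: "X \<in> Pos_sets (Ker \<phi>)" "X \<union> Pos_plus \<phi> \<in> U" by auto
      from U X(2) obtain E where E: "finite E" "X \<union> Pos_plus \<phi> \<in> avoiding UNIV E"
        "avoiding UNIV E \<subseteq> U"
        by (rule openin_Pos_topologyE)
      \<comment> \<open>Only \<open>E \<inter> Ker \<phi>\<close> constrains X': \<open>E\<close>
        already misses Pos+ \<phi>, and X' lies in the kernel.\<close>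
      have "X' \<union> Pos_plus \<phi> \<in> U" if "X' \<in> avoiding (Ker \<phi>) (E \<inter> Ker \<phi>)" for X'
      proof -
        have X': "X' \<in> Pos_sets (Ker \<phi>)" "X' \<inter> E = {}"
          using that Ker[of X'] by (auto simp: avoiding_def)
        then have "X' \<union> Pos_plus \<phi> \<in> avoiding UNIV E"
          using E(2) fibre[OF X'(1)] by (auto simp: avoiding_def ray_fibre_def)
        then show ?thesis using E(3) by blast
      qed
      then show "\<exists>E. finite E \<and> E \<subseteq> Ker \<phi> \<and> X \<in> avoiding (Ker \<phi>) E \<and>
          avoiding (Ker \<phi>) E \<subseteq> {X \<in> topspace (Pos_topology (Ker \<phi>)). X \<union> Pos_plus \<phi> \<in> U}"
        using X(1) E(1,2) by (intro exI[of _ "E \<inter> Ker \<phi>"]) (auto simp: avoiding_def)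
    qed auto
  qed
  \<comment> \<open>The inverse is continuous on the whole space and is restricted to the fibre
    afterwards.\<close>
  moreover have "continuous_map (Pos_topology UNIV) (Pos_topology (Ker \<phi>)) (\<lambda>Y. Y \<inter> Ker \<phi>)"
    unfolding continuous_map
  proof (intro conjI allI impI)
    show "(\<lambda>Y. Y \<inter> Ker \<phi>) ` topspace (Pos_topology UNIV) \<subseteq> topspace (Pos_topology (Ker \<phi>))"
      using restrict by auto
    fix U :: "'l set set" assume U: "openin (Pos_topology (Ker \<phi>)) U"
    show "openin (Pos_topology UNIV) {Y \<in> topspace (Pos_topology UNIV). Y \<inter> Ker \<phi> \<in> U}"
      unfolding openin_Pos_topology
    proof (intro conjI ballI)
      fix Y assume "Y \<in> {Y \<in> topspace (Pos_topology UNIV). Y \<inter> Ker \<phi> \<in> U}"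
      then have Y: "Y \<in> Pos_sets UNIV" "Y \<inter> Ker \<phi> \<in> U" by auto
      from U Y(2) obtain E where E: "finite E" "E \<subseteq> Ker \<phi>" "Y \<inter> Ker \<phi> \<in> avoiding (Ker \<phi>) E"
        "avoiding (Ker \<phi>) E \<subseteq> U"
        by (rule openin_Pos_topologyE)
      have "Z \<inter> Ker \<phi> \<in> U" if "Z \<in> avoiding UNIV E" for Z
        using that restrict[of Z] E(4) by (auto simp: avoiding_def)
      then show "\<exists>E. finite E \<and> E \<subseteq> UNIV \<and> Y \<in> avoiding UNIV E \<and>
          avoiding UNIV E \<subseteq> {Y \<in> topspace (Pos_topology UNIV). Y \<inter> Ker \<phi> \<in> U}"
        using Y(1) E(1-3) by (intro exI[of _ E]) (auto simp: avoiding_def)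
    qed auto
  qed
  moreover have "ray_fibre (ray \<phi>) \<subseteq> Pos_sets UNIV" by (auto simp: ray_fibre_def)
  ultimately have "homeomorphic_maps (Pos_topology (Ker \<phi>))
      (subtopology (Pos_topology UNIV) (ray_fibre (ray \<phi>))) (\<lambda>X. X \<union> Pos_plus \<phi>) (\<lambda>Y. Y \<inter> Ker \<phi>)"
    unfolding homeomorphic_maps_def
    by (intro conjI ballI continuous_map_into_subtopology continuous_map_from_subtopology)
      (simp_all add: fibre left right Pi_iff)
  then show ?thesis using homeomorphic_map_maps by blast
qed

end

section \<open>Connectedness and failure of the Hausdorff property\<close>

text \<open>The empty set is the only finite set avoided by \<open>\<Lambda>\<close>, so \<open>\<Lambda>\<close> lies in no proper open subset.\<close>

lemma openin_Pos_topology_UNIV_mem: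
  assumes "openin (Pos_topology UNIV) U" "UNIV \<in> U"
  shows "U = Pos_sets UNIV"
proof -
  from assms obtain E :: "'a set" where E: "finite E" "E \<subseteq> UNIV" "UNIV \<in> avoiding UNIV E"
    "avoiding UNIV E \<subseteq> U"
    by (rule openin_Pos_topologyE)
  from E(3) have "E = {}" by (simp add: avoiding_def)
  with E(4) have "Pos_sets UNIV \<subseteq> U" by (simp add: avoiding_def)
  with openin_subset[OF assms(1)] show ?thesis by simp
qed

text \<open>In a cover by two open sets, the one containing the whole lattice is the entire space,
  so the other cannot be nonempty and disjoint from it.\<close>

lemma connected_space_Pos_topology: "connected_space (Pos_topology UNIV)"
  unfolding connected_space_def topspace_Pos_topology
proof (intro notI, elim exE conjE)
  fix U V :: "'a set set"
  assume UV: "openin (Pos_topology UNIV) U" "openin (Pos_topology UNIV) V"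
    "Pos_sets UNIV \<subseteq> U \<union> V" "U \<inter> V = {}" "U \<noteq> {}" "V \<noteq> {}"
  then have "UNIV \<in> U \<or> UNIV \<in> V" using UNIV_in_Pos_sets by blast
  then have "U = Pos_sets UNIV \<or> V = Pos_sets UNIV"
    using UV(1,2) openin_Pos_topology_UNIV_mem by blast
  moreover have "U \<subseteq> Pos_sets UNIV" "V \<subseteq> Pos_sets UNIV"
    using openin_subset[OF UV(1)] openin_subset[OF UV(2)] by simp_all
  ultimately show False using UV(4-6) by blast
qed

text \<open>Every neighbourhood of the whole lattice contains X, so the two points cannot be
  separated.\<close>

lemma not_Hausdorff_Pos_topology:
  fixes X :: "'l::ab_group_add set"
  assumes "X \<in> Pos_sets UNIV" "X \<noteq> UNIV"
  shows "\<not> Hausdorff_space (Pos_topology (UNIV :: 'l set))"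
proof
  assume "Hausdorff_space (Pos_topology (UNIV :: 'l set))"
  then obtain U V where "openin (Pos_topology UNIV) U" "openin (Pos_topology UNIV) V"
    "X \<in> U" "UNIV \<in> V" "disjnt U V"
    using assms UNIV_in_Pos_sets unfolding Hausdorff_space_def topspace_Pos_topology by metis
  with openin_Pos_topology_UNIV_mem[of V] assms(1) show False unfolding disjnt_def by blast
qed

theorem mainTheorem1:
  fixes \<phi> :: "'l::ab_group_add real_tensor \<Rightarrow> real"
  assumes "is_lattice (UNIV :: 'l set)"
    and "(UNIV :: 'l set) \<noteq> {0}"
    and "linear \<phi>"
    and "\<phi> \<noteq> (\<lambda>_. 0)"
  shows
    "(connected_space (Pos_topology (UNIV :: 'l set)) \<and>
      \<not> Hausdorff_space (Pos_topology (UNIV :: 'l set)))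
     \<and>
     (continuous_map (Pos_topology (UNIV :: 'l set)) ray_topology ray_of \<and>
      continuous_map ray_topology (Pos_topology (UNIV :: 'l set)) Pos_bar \<and>
      (\<forall>c \<in> topspace (ray_topology :: ('l real_tensor \<Rightarrow> real) set topology).
         ray_of (Pos_bar c) = c))
     \<and>
     (embedding_map ray_topology (Pos_topology (UNIV :: 'l set)) Pos_bar \<and>
      Pos_topology (UNIV :: 'l set) closure_of (Pos_bar ` topspace ray_topology) =
        topspace (Pos_topology UNIV))
     \<and>
     ray_fibre (ray \<phi>) =
       \<Inter>{N. N \<subseteq> topspace (Pos_topology UNIV) \<and>
          (\<exists>U. openin (Pos_topology UNIV) U \<and> Pos \<phi> \<in> U \<and> U \<subseteq> N)}
     \<and>
     homeomorphic_map (Pos_topology (Ker \<phi>))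
       (subtopology (Pos_topology UNIV) (ray_fibre (ray \<phi>)))
       (\<lambda>X. X \<union> Pos_plus \<phi>)"
proof -
  obtain n and f :: "'l \<Rightarrow> nat \<Rightarrow> int" where "lattice_coordinates n f"
    using assms(1) unfolding is_lattice_def lattice_coordinates_def by blast
  then interpret lattice_coordinates n f .
  have left_inverse: "\<forall>c \<in> topspace (ray_topology :: ('l real_tensor \<Rightarrow> real) set topology).
      ray_of (Pos_bar c) = c"
    by (auto simp: topspace_ray_topology dual_def Pos_bar_ray ray_of_Pos)
  \<comment> \<open>A continuous map with a continuous left inverse, here \<open>ray_of\<close>, is
    an embedding.\<close>
  have "embedding_map ray_topology (Pos_topology (UNIV :: 'l set)) Pos_bar"
    using left_inverse continuous_map_ray_of continuous_map_Pos_bar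
    by (intro section_imp_embedding_map) (auto simp: section_map_def retraction_maps_def)
  \<comment> \<open>Pos \<phi> serves as the positive subset different from the whole
    lattice.\<close>
  moreover have "\<not> Hausdorff_space (Pos_topology (UNIV :: 'l set))"
    using not_Hausdorff_Pos_topology Pos_in_Pos_sets Pos_neq_UNIV assms(3,4) by blast
  ultimately show ?thesis
    by (intro conjI left_inverse connected_space_Pos_topology continuous_map_ray_of
        continuous_map_Pos_bar dense_Pos_bar ray_fibre_eq_Inter_neighbourhoods[OF assms(3,4)]
        homeomorphic_map_Un_Pos_plus[OF assms(3,4)])
qed

end
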